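(* Let $d\ge1$, let $\lambda=(\lambda_1,\dots,\lambda_d)$ be a composition of a positive integer $n$, and let $w$ be a $\lambda$-permutation. The lifted monotone $\lambda$-path $\gamma^w$ is $\pi$-coherent if and only if $w$ is non-nesting. The number of such paths, which equals the number of lower vertices of $\Pi_d(\lambda)$ and the number of regions of $\mathcal A_d(\lambda)$, is $\frac{n!}{(n-d+1)!}$; in particular it depends only on $n$ and $d$.
   Context: Here $\lambda$ being a composition of $n$ means the $\lambda_i$ are positive integers with $\lambda_1+\cdots+\lambda_d=n$. Let $f(x)=x_1^2+\cdots+x_d^2$, $B(\lambda)=\{x\in\mathbb R^d:0\le x_i\le\lambda_i\}$, and $\widetilde{\mathcal P}_{d+1}(\lambda)=\mathrm{conv}\{(x,f(x)):x\in B(\lambda)\cap\mathbb Z^d\}\subset\mathbb R^{d+1}$. Let $\pi:\mathbb R^{d+1}\to\mathbb R$, $\pi(x)=x_1+\cdots+x_d$. A $\lambda$-permutation is a word $w=w_1\cdots w_n$ that is a permutation of the multiset containing each $i\in\{1,\dots,d\}$ exactly $\lambda_i$ times. Its monotone $\lambda$-path is $p^w=(v_0,\dots,v_n)$ with $v_0=0$ and $v_k=v_{k-1}+e_{w_k}$ ($e_i$ the unit coordinate vectors of $\mathbb R^d$), and its lift is the edge path $\gamma^w=(\tilde v_0,\dots,\tilde v_n)$ of $\widetilde{\mathcal P}_{d+1}(\lambda)$ with $\tilde v_k=(v_k,f(v_k))$. A maximal $\pi$-monotone edge path $p$ of $\widetilde{\mathcal P}_{d+1}(\lambda)$ is $\pi$-coherent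 if there is a linear functional $c$ on $\mathbb R^{d+1}$ such that, with $\pi^c(x)=(\pi(x),c(x))\in\mathbb R^2$, the set of points of $\widetilde{\mathcal P}_{d+1}(\lambda)$ mapped by $\pi^c$ into the lower boundary chain (with respect to the second coordinate) of the polygon $\pi^c(\widetilde{\mathcal P}_{d+1}(\lambda))$ is exactly the path $p$. The $\lambda$-permutation $w$ is nesting if there are indices $1\le i<j<k<l\le n$ with $w_i=w_l$, $w_j=w_k$, and $w_m\ne w_i$ for all $j\le m\le k$; otherwise it is non-nesting. $\Pi_d(\lambda)$ is the monotone path polytope, i.e. the set of all points $\frac1n\int_0^n\gamma(t)\,dt$ over continuous $\gamma:[0,n]\to\widetilde{\mathcal P}_{d+1}(\lambda)$ with $\pi(\gamma(t))=t$; a lower vertex is a vertex maximizing some linear functional with negative $(d+1)$st coefficient. The arrangement $\mathcal A_d(\lambda)$ in $\mathbb R^d$ consists of the hyperplanes $x_i-x_j=m$ for $1\le i<j\le d$ and integers $-\lambda_i+1\le m\le\lambda_j-1$; its regions are the connected components of the complement of the union of its hyperplanes. *)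

theory Defs
  imports "HOL-Analysis.Analysis" "HOL-Library.Multiset"
begin

text \<open>
  The index set \<open>{1,\<dots>,d}\<close> is an arbitrary finite linearly ordered type \<open>'d\<close>, so \<open>d = CARD('d)\<close>;
  \<open>\<real>\<^sup>d\<close> is \<open>real ^ 'd\<close> and \<open>\<real>\<^sup>d\<^sup>+\<^sup>1\<close> is \<open>(real ^ 'd) \<times> real\<close>, the second component being
  the \<open>(d+1)\<close>st coordinate.
\<close>

definition composition :: "('d::finite \<Rightarrow> nat) \<Rightarrow> nat \<Rightarrow> bool" where
  "composition lam n \<longleftrightarrow> (\<forall>i. 0 < lam i) \<and> (\<Sum>i\<in>UNIV. lam i) = n"

definition sqsum :: "real ^ 'd::finite \<Rightarrow> real" where
  "sqsum x = (\<Sum>i\<in>UNIV. (x $ i)\<^sup>2)"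

definition lift_pt :: "real ^ 'd::finite \<Rightarrow> (real ^ 'd) \<times> real" where
  "lift_pt x = (x, sqsum x)"

definition lambda_box :: "('d::finite \<Rightarrow> nat) \<Rightarrow> (real ^ 'd) set" where
  "lambda_box lam = {x. \<forall>i. 0 \<le> x $ i \<and> x $ i \<le> real (lam i)}"

definition lattice_points :: "(real ^ 'd::finite) set" where
  "lattice_points = {x. \<forall>i. x $ i \<in> \<int>}"

definition lifted_polytope :: "('d::finite \<Rightarrow> nat) \<Rightarrow> ((real ^ 'd) \<times> real) set" where
  "lifted_polytope lam = convex hull (lift_pt ` (lambda_box lam \<inter> lattice_points))"

definition height :: "(real ^ 'd::finite) \<times> real \<Rightarrow> real" where
  "height z = (\<Sum>i\<in>UNIV. fst z $ i)"

text \<open>Edge paths are represented by their lists of successive vertices.\<close>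

definition monotone_edge_path ::
    "('a::euclidean_space \<Rightarrow> real) \<Rightarrow> 'a set \<Rightarrow> 'a list \<Rightarrow> bool" where
  "monotone_edge_path \<phi> P p \<longleftrightarrow>
     p \<noteq> [] \<and> (\<forall>v\<in>set p. v extreme_point_of P) \<and>
     (\<forall>k. Suc k < length p \<longrightarrow>
        closed_segment (p ! k) (p ! Suc k) edge_of P \<and> \<phi> (p ! k) < \<phi> (p ! Suc k))"

definition maximal_monotone_edge_path ::
    "('a::euclidean_space \<Rightarrow> real) \<Rightarrow> 'a set \<Rightarrow> 'a list \<Rightarrow> bool" where
  "maximal_monotone_edge_path \<phi> P p \<longleftrightarrow>
     monotone_edge_path \<phi> P p \<and>
     (\<forall>us vs. monotone_edge_path \<phi> P (us @ p @ vs) \<longrightarrow> us = [] \<and> vs = [])"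

definition path_points :: "'a::real_vector list \<Rightarrow> 'a set" where
  "path_points p =
     set p \<union> (\<Union>k\<in>{k. Suc k < length p}. closed_segment (p ! k) (p ! Suc k))"

definition lower_boundary :: "(real \<times> real) set \<Rightarrow> (real \<times> real) set" where
  "lower_boundary Q = {(t, s). (t, s) \<in> Q \<and> (\<forall>s'. (t, s') \<in> Q \<longrightarrow> s \<le> s')}"

definition coherent ::
    "('a::euclidean_space \<Rightarrow> real) \<Rightarrow> 'a set \<Rightarrow> 'a list \<Rightarrow> bool" where
  "coherent \<phi> P p \<longleftrightarrow>
     maximal_monotone_edge_path \<phi> P p \<and>
     (\<exists>c. linear c \<and>
        {x \<in> P. (\<phi> x, c x) \<in> lower_boundary ((\<lambda>y. (\<phi> y, c y)) ` P)} = path_points p)"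

definition lambda_permutation :: "('d::finite \<Rightarrow> nat) \<Rightarrow> 'd list \<Rightarrow> bool" where
  "lambda_permutation lam w \<longleftrightarrow> (\<forall>i. count (mset w) i = lam i)"

primrec path_vertex :: "('d::finite) list \<Rightarrow> nat \<Rightarrow> real ^ 'd" where
  "path_vertex w 0 = 0"
| "path_vertex w (Suc k) = path_vertex w k + axis (w ! k) 1"  (* letters are numbered from 0 *)

definition lifted_path :: "('d::finite) list \<Rightarrow> ((real ^ 'd) \<times> real) list" where
  "lifted_path w = map (\<lambda>k. lift_pt (path_vertex w k)) [0..<Suc (length w)]"

definition nesting :: "'a list \<Rightarrow> bool" where
  "nesting w \<longleftrightarrow>
     (\<exists>i j k l. i < j \<and> j < k \<and> k < l \<and> l < length w \<and>
        w ! i = w ! l \<and> w ! j = w ! k \<and> (\<forall>m. j \<le> m \<and> m \<le> k \<longrightarrow> w ! m \<noteq> w ! i))"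

definition monotone_path_polytope ::
    "nat \<Rightarrow> ('d::finite \<Rightarrow> nat) \<Rightarrow> ((real ^ 'd) \<times> real) set" where
  "monotone_path_polytope n lam =
     {(1 / real n) *\<^sub>R integral {0..real n} \<gamma> | \<gamma>.
        continuous_on {0..real n} \<gamma> \<and>
        (\<forall>t\<in>{0..real n}. \<gamma> t \<in> lifted_polytope lam \<and> height (\<gamma> t) = t)}"

text \<open>For a linear functional \<open>c\<close>, the value \<open>c (0, 1)\<close> is its \<open>(d+1)\<close>st coefficient.\<close>

definition lower_vertex ::
    "((real ^ 'd::finite) \<times> real) set \<Rightarrow> (real ^ 'd) \<times> real \<Rightarrow> bool" where
  "lower_vertex Q v \<longleftrightarrow>
     v extreme_point_of Q \<and>
     (\<exists>c :: (real ^ 'd) \<times> real \<Rightarrow> real. linear c \<and> c (0, 1) < 0 \<and> (\<forall>x\<in>Q. c x \<le> c v))"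

definition arrangement :: "('d::{finite,linorder} \<Rightarrow> nat) \<Rightarrow> (real, 'd) vec set set" where
  "arrangement lam =
     {{x. x $ i - x $ j = real_of_int m} | i j m.
        i < j \<and> - int (lam i) + 1 \<le> m \<and> m \<le> int (lam j) - 1}"

definition regions :: "(real ^ 'd::finite) set set \<Rightarrow> (real ^ 'd) set set" where
  "regions H = components (- \<Union>H)"

end

theory Submission
  imports Defs
begin

text \<open>
  A functional \<open>c (x, s) = s + \<Sum>i. (2 y\<^sub>i - 1) x\<^sub>i\<close> charges \<open>2 (y\<^sub>i + m)\<close> for raising the
  \<open>i\<close>th coordinate from \<open>m\<close> to \<open>m + 1\<close>. This cost is separable and convex, so the cheapest
  lattice points are found greedily: \<open>\<gamma>\<^sup>w\<close> is the lower chain for \<open>c\<close> exactly when the costs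
  along \<open>w\<close> strictly increase (\<open>w\<close> is realized by \<open>y\<close>). The \<open>y\<close> whose costs are pairwise distinct
  form the complement of the arrangement, and those realizing a given word form one region; the
  lower vertices are the centroids of the realizable paths. Equal letters have costs differing by
  integers, which rules out nestings; conversely, in a non-nesting word repeated letters leave a
  first-in first-out queue, so costs can be chosen from left to right. A word of this kind is
  determined by where the new letters are inserted, and these are counted by a ballot recursion.
\<close>

text \<open>The constants in \<open>c\<close> come from \<open>(m + 1)^2 - m^2 = 2 m + 1\<close>:
  the coefficient \<open>2 y\<^sub>i - 1\<close> cancels the 1 and makes every marginal cost twice a
  number of the form \<open>y\<^sub>i + m\<close>. Only a functional with positive last coefficient
  can be rescaled to this form, whereas coherence presupposes no sign. If no letter repeats, the
  lifted polytope lies in the hyperplane where the last coordinate equals the height, and coherence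
  leaves the sign open; but such a word cannot nest. A repeated letter does force the sign, so the
  converse direction assumes a nesting and uses it twice: for the sign and for the contradiction. On
  the side of lower vertices the obstacle is that \<open>monotone_path_polytope\<close> is given as
  a set of integrals, with no list of vertices, and that a functional maximal at a lower vertex may
  have coinciding costs. Hence a supposed lower vertex is separated from the hull of the finitely
  many centroids, instead of being matched with a path directly.\<close>

subsection \<open>Realizable words\<close>

definition step_cost :: "('a \<Rightarrow> real) \<Rightarrow> 'a list \<Rightarrow> nat \<Rightarrow> real" where
  "step_cost y w k = y (w ! k) + real (count (mset (take k w)) (w ! k))"

definition realizes :: "('a \<Rightarrow> real) \<Rightarrow> 'a list \<Rightarrow> bool" where
  "realizes y w \<longleftrightarrow> (\<forall>j k. j < k \<longrightarrow> k < length w \<longrightarrow> step_cost y w j < step_cost y w k)"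

lemma step_cost_Cons_0 [simp]: "step_cost y (a # w) 0 = y a"
  by (simp add: step_cost_def)

text \<open>Having taken one step \<open>a\<close> amounts to starting with \<open>y a\<close> one
  higher. This shift lets the inductions that build or compare realized words peel off the first
  letter.\<close>

lemma step_cost_Cons_Suc [simp]:
  "step_cost y (a # w) (Suc k) = step_cost (y(a := y a + 1)) w k"
  by (simp add: step_cost_def)

lemma realizes_Nil [simp]: "realizes y []"
  by (simp add: realizes_def)

lemma realizes_Cons:
  "realizes y (a # w) \<longleftrightarrow>
     (\<forall>k<length w. y a < step_cost (y(a := y a + 1)) w k) \<and> realizes (y(a := y a + 1)) w"
  unfolding realizes_def
proof (intro iffI conjI allI impI)
  fix k assume H: "\<forall>j k. j < k \<longrightarrow> k < length (a # w) \<longrightarrow> step_cost y (a # w) j < step_cost y (a # w) k"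
  show "y a < step_cost (y(a := y a + 1)) w k" if "k < length w"
    using H[rule_format, of 0 "Suc k"] that by simp
next
  fix j k assume H: "\<forall>j k. j < k \<longrightarrow> k < length (a # w) \<longrightarrow> step_cost y (a # w) j < step_cost y (a # w) k"
  show "step_cost (y(a := y a + 1)) w j < step_cost (y(a := y a + 1)) w k"
    if "j < k" "k < length w"
    using H[rule_format, of "Suc j" "Suc k"] that by simp
next
  fix j k
  assume "(\<forall>k<length w. y a < step_cost (y(a := y a + 1)) w k) \<and>
     (\<forall>j k. j < k \<longrightarrow> k < length w \<longrightarrow>
        step_cost (y(a := y a + 1)) w j < step_cost (y(a := y a + 1)) w k)"
    and "j < k" "k < length (a # w)"
  then show "step_cost y (a # w) j < step_cost y (a # w) k"
    by (cases j; cases k) auto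
qed

lemma realizesI_adjacent:
  assumes "\<And>k. Suc k < length w \<Longrightarrow> step_cost y w k < step_cost y w (Suc k)"
  shows "realizes y w"
  unfolding realizes_def
proof (intro allI impI)
  fix j k :: nat assume "j < k" "k < length w"
  then show "step_cost y w j < step_cost y w k"
  proof (induction k)
    case (Suc k)
    then show ?case
      using assms[of k] by (cases "j = k") auto
  qed simp
qed

section \<open>Occurrences of a letter in prefixes\<close>

lemma count_take_mono: "j \<le> k \<Longrightarrow> count (mset (take j w)) i \<le> count (mset (take k w)) i"
proof -
  assume "j \<le> k"
  then have "take k w = take j w @ take (k - j) (drop j w)"
    by (metis le_add_diff_inverse take_add)
  then show ?thesis by simp
qed

lemma count_take_le: "count (mset (take j w)) i \<le> count (mset w) i"
  by (metis count_take_mono nat_le_linear take_all)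

lemma count_take_Suc:
  "k < length w \<Longrightarrow> count (mset (take (Suc k) w)) i
     = count (mset (take k w)) i + (if w ! k = i then 1 else 0)"
  by (simp add: take_Suc_conv_app_nth)

text \<open>Locates the occurrence of \<open>i\<close> with number \<open>m\<close>, counted from 0;
  the step made there costs exactly \<open>y i + real m\<close>.\<close>

lemma occurrence_position:
  "m < count (mset (take k w)) i \<Longrightarrow>
     \<exists>j<k. j < length w \<and> w ! j = i \<and> count (mset (take j w)) i = m"
proof (induction k)
  case (Suc k)
  show ?case
  proof (cases "k < length w")
    case True
    show ?thesis
    proof (cases "m < count (mset (take k w)) i")
      case True
      then show ?thesis using Suc.IH less_SucI by blast
    next
      case False
      with Suc.prems \<open>k < length w\<close> have "w ! k = i" "m = count (mset (take k w)) i"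
        by (auto simp: count_take_Suc split: if_splits)
      then show ?thesis using True by blast
    qed
  next
    case False
    then have "take (Suc k) w = take k w" by simp
    then show ?thesis using Suc less_SucI by metis
  qed
qed simp

text \<open>The latest \<open>i\<close>-step before \<open>k\<close> costs \<open>y i\<close> plus
  one less than the current count, and costs increase along the word.\<close>

lemma realizes_lower_bound:
  assumes "realizes y w" "k < length w" "0 < count (mset (take k w)) i"
  shows "y i + real (count (mset (take k w)) i) - 1 < step_cost y w k"
proof -
  obtain j where j: "j < k" "w ! j = i" "count (mset (take j w)) i = count (mset (take k w)) i - 1"
    using occurrence_position[of "count (mset (take k w)) i - 1" k w i] assms(3) by auto
  have "step_cost y w j = y i + real (count (mset (take k w)) i) - 1"
    unfolding step_cost_def j using assms(3) by (simp add: of_nat_diff j)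
  then show ?thesis using assms(1,2) j(1) unfolding realizes_def by metis
qed

text \<open>The next \<open>i\<close>-step is still to come and costs \<open>y i\<close> plus the
  current count; as \<open>w ! k \<noteq> i\<close>, it comes strictly after
  \<open>k\<close>.\<close>

lemma realizes_upper_bound:
  assumes "realizes y w" "k < length w" "count (mset (take k w)) i < count (mset w) i" "w ! k \<noteq> i"
  shows "step_cost y w k < y i + real (count (mset (take k w)) i)"
proof -
  obtain j where j: "j < length w" "w ! j = i"
    "count (mset (take j w)) i = count (mset (take k w)) i"
    using occurrence_position[of _ "length w" w i] assms(3) by auto
  have "\<not> j < k"
  proof
    assume "j < k"
    then have "count (mset (take (Suc j) w)) i \<le> count (mset (take k w)) i"
      by (intro count_take_mono) simp
    then show False using j by (simp add: count_take_Suc)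
  qed
  with j assms(4) have "k < j" by (metis linorder_neqE_nat)
  then have "step_cost y w k < step_cost y w j"
    using assms(1) j(1) unfolding realizes_def by blast
  also have "step_cost y w j = y i + real (count (mset (take k w)) i)"
    unfolding step_cost_def j(2) j(3) ..
  finally show ?thesis .
qed

text \<open>Between consecutive occurrences of \<open>a\<close> the cost climbs by exactly 1, so all
  steps strictly in between have costs less than 1 apart. Two equal letters there would differ by at
  least 1.\<close>

lemma realizes_imp_not_nesting:
  assumes "realizes y w" shows "\<not> nesting w"
proof
  assume "nesting w"
  then obtain i j k l where ijkl: "i < j" "j < k" "k < l" "l < length w"
    and eq: "w ! i = w ! l" "w ! j = w ! k" and no: "\<And>m. j \<le> m \<Longrightarrow> m \<le> k \<Longrightarrow> w ! m \<noteq> w ! i"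
    unfolding nesting_def by blast
  define a where "a = w ! i"
  \<comment> \<open>Only the stretch from \<open>j\<close> to \<open>k\<close> is known to be free
    of \<open>a\<close>; \<open>i\<close> and \<open>l\<close> need not be consecutive occurrences.
    The window is therefore bounded by the last \<open>a\<close> before \<open>j\<close> and the
    first \<open>a\<close> after \<open>k\<close>, for which equal counts at \<open>j\<close> and
    \<open>k\<close> suffice.\<close>
  have "count (mset (take (j + d) w)) a = count (mset (take j w)) a" if "j + d \<le> k" for d
    using that
  proof (induction d)
    case (Suc d)
    then show ?case
      using no[of "j + d"] ijkl by (simp add: count_take_Suc a_def)
  qed simp
  from this[of "k - j"] have cnt: "count (mset (take k w)) a = count (mset (take j w)) a"
    using ijkl by simp
  have i_less: "i < length w" using ijkl by simp
  have "count (mset (take (Suc i) w)) a \<le> count (mset (take j w)) a"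
    using ijkl by (intro count_take_mono) simp
  then have pos: "0 < count (mset (take j w)) a"
    unfolding count_take_Suc[OF i_less] by (simp add: a_def del: count_greater_zero_iff)
  have "count (mset (take k w)) a \<le> count (mset (take l w)) a"
    using ijkl by (intro count_take_mono) simp
  also have "\<dots> < count (mset (take (Suc l) w)) a"
    using ijkl eq by (simp add: count_take_Suc a_def)
  also have "\<dots> \<le> count (mset w) a" by (rule count_take_le)
  finally have more: "count (mset (take k w)) a < count (mset w) a" .
  have "y a + real (count (mset (take j w)) a) - 1 < step_cost y w j"
    using realizes_lower_bound[OF assms _ pos] ijkl by simp
  moreover have "step_cost y w k < y a + real (count (mset (take k w)) a)"
    using realizes_upper_bound[OF assms _ more] no[of k] ijkl by (simp add: a_def)
  moreover have "step_cost y w j + 1 \<le> step_cost y w k"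
  proof -
    have "count (mset (take (Suc j) w)) (w ! k) \<le> count (mset (take k w)) (w ! k)"
      using ijkl by (intro count_take_mono) simp
    then have "Suc (count (mset (take j w)) (w ! k)) \<le> count (mset (take k w)) (w ! k)"
      using ijkl eq by (simp add: count_take_Suc)
    then have "real (count (mset (take j w)) (w ! k)) + 1 \<le> real (count (mset (take k w)) (w ! k))"
      by linarith
    then show ?thesis by (simp add: step_cost_def eq)
  qed
  ultimately show False using cnt by simp
qed

text \<open>\<open>q\<close> lists the letters that have occurred and will occur again, oldest last occurrence
  first, and \<open>r\<close> counts the occurrences still to come.\<close>

primrec fifo :: "'a list \<Rightarrow> ('a \<Rightarrow> nat) \<Rightarrow> 'a list \<Rightarrow> bool" where
  "fifo q r [] \<longleftrightarrow> (\<forall>i. r i = 0)"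
| "fifo q r (a # w) \<longleftrightarrow> 0 < r a \<and> (a \<in> set q \<longrightarrow> a = hd q) \<and>
     fifo (remove1 a q @ (if 1 < r a then [a] else [])) (r(a := r a - 1)) w"

definition valid_queue :: "'a list \<Rightarrow> ('a \<Rightarrow> nat) \<Rightarrow> bool" where
  "valid_queue q r \<longleftrightarrow> distinct q \<and> (\<forall>i\<in>set q. 0 < r i)"

lemma valid_queue_step:
  assumes "valid_queue q r"
  shows "valid_queue (remove1 a q @ (if 1 < r a then [a] else [])) (r(a := r a - 1))"
  using assms by (auto simp: valid_queue_def)

lemma fifo_imp_count: "fifo q r w \<Longrightarrow> count (mset w) i = r i"
proof (induction w arbitrary: q r)
  case (Cons a w)
  then have "count (mset w) i = (r(a := r a - 1)) i" "0 < r a" by auto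
  then show ?case by (simp split: if_splits)
qed simp

section \<open>From non-nesting words to queues\<close>

lemma nesting_append: "nesting w \<Longrightarrow> nesting (u @ w)"
proof -
  assume "nesting w"
  then obtain i j k l where "i < j" "j < k" "k < l" "l < length w"
    "w ! i = w ! l" "w ! j = w ! k" and no: "\<And>m. j \<le> m \<Longrightarrow> m \<le> k \<Longrightarrow> w ! m \<noteq> w ! i"
    unfolding nesting_def by blast
  moreover have "(u @ w) ! m \<noteq> w ! i" if "length u + j \<le> m" "m \<le> length u + k" for m
    using no[of "m - length u"] that by (auto simp: nth_append)
  ultimately show ?thesis
    unfolding nesting_def
    by (intro exI[of _ "length u + i"] exI[of _ "length u + j"] exI[of _ "length u + k"]
        exI[of _ "length u + l"]) auto
qed

text \<open>Serves the last occurrence of a letter: it is then dropped from the middle of the word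
  that the next induction follows, and dropping it must not create a nesting.\<close>

lemma nesting_insert_fresh:
  assumes "nesting (u @ w)" "a \<notin> set u" "a \<notin> set w"
  shows "nesting (u @ a # w)"
proof -
  obtain i j k l where ijkl: "i < j" "j < k" "k < l" "l < length (u @ w)"
    "(u @ w) ! i = (u @ w) ! l" "(u @ w) ! j = (u @ w) ! k"
    and no: "\<And>m. j \<le> m \<Longrightarrow> m \<le> k \<Longrightarrow> (u @ w) ! m \<noteq> (u @ w) ! i"
    using assms(1) unfolding nesting_def by blast
  define f where "f m = (if m < length u then m else Suc m)" for m
  have nth: "(u @ a # w) ! f m = (u @ w) ! m" for m
    by (auto simp: f_def nth_append Suc_diff_le)
  have mono: "f m < f m'" if "m < m'" for m m'
    using that by (auto simp: f_def)
  have "(u @ a # w) ! m \<noteq> (u @ a # w) ! f i" if "f j \<le> m" "m \<le> f k" for m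
  proof (cases "m = length u")
    case True
    have "(u @ w) ! i \<in> set (u @ w)" using ijkl by (intro nth_mem) simp
    then show ?thesis using assms(2,3) True unfolding nth by auto
  next
    case False
    define m' where "m' = (if m < length u then m else m - 1)"
    have m': "m = f m'" using False by (auto simp: f_def m'_def)
    then have "j \<le> m'" "m' \<le> k" using that mono[of m' j] mono[of k m'] by (auto simp: not_less[symmetric])
    then show ?thesis unfolding m' nth by (rule no)
  qed
  moreover have "f l < length (u @ a # w)" using ijkl by (simp add: f_def)
  ultimately show ?thesis
    unfolding nesting_def using ijkl mono nth
    by (intro exI[of _ "f i"] exI[of _ "f j"] exI[of _ "f k"] exI[of _ "f l"]) auto
qed

text \<open>For later nestings, the prefix already read is represented by the last occurrences of
  its pending letters, in order, which is \<open>q\<close>; so the invariant concerns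
  \<open>q @ w\<close>. Reading a letter \<open>a\<close> that will recur moves it to the rear of
  the queue, that is, turns \<open>q @ a # w\<close> into
  \<open>remove1 a q @ a # w\<close>.\<close>

lemma not_nesting_imp_fifo:
  assumes "valid_queue q r" "\<not> nesting (q @ w)" "\<And>i. count (mset w) i = r i"
  shows "fifo q r w"
  using assms
proof (induction w arbitrary: q r)
  case Nil
  then show ?case by (metis count_empty fifo.simps(1) mset.simps(1))
next
  case (Cons a w)
  define r' where "r' = r(a := r a - 1)"
  define q' where "q' = remove1 a q @ (if 1 < r a then [a] else [])"
  have ra: "r a = Suc (count (mset w) a)" using Cons.prems(3)[of a] by simp
  have cw: "count (mset w) i = r' i" for i
    using Cons.prems(3)[of i] ra by (auto simp: r'_def split: if_splits)
  have hd: "a = hd q" if "a \<in> set q"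
  proof (rule ccontr)
    assume ne: "a \<noteq> hd q"
    \<comment> \<open>If \<open>a\<close> were pending behind the head \<open>b\<close>, then the
      queued \<open>b\<close>, the queued \<open>a\<close>, the \<open>a\<close> being read and a
      later \<open>b\<close> in \<open>w\<close> would nest: \<open>b\<close> does not recur in
      \<open>u\<close>.\<close>
    from that obtain b u where q: "q = b # u" by (cases q) auto
    with ne that have ab: "a \<noteq> b" "a \<in> set u" by auto
    have "0 < count (mset (a # w)) b" using Cons.prems(1,3) q by (auto simp: valid_queue_def)
    with ab have "b \<in> set w" by simp
    then obtain l where l: "l < length w" "w ! l = b" by (metis in_set_conv_nth)
    obtain j where j: "j < length u" "u ! j = a" using ab by (metis in_set_conv_nth)
    have bu: "b \<notin> set u" using Cons.prems(1) q by (simp add: valid_queue_def)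
    have no: "(u @ a # w) ! m \<noteq> b" if "m \<le> length u" for m
      using that bu ab by (auto simp: nth_append nth_Cons split: nat.splits)
    have "nesting (q @ a # w)"
      unfolding nesting_def
    proof (intro exI conjI)
      show "0 < Suc j" "Suc j < Suc (length u)" "Suc (length u) < Suc (Suc (length u)) + l" using j by auto
      show "\<forall>m. Suc j \<le> m \<and> m \<le> Suc (length u) \<longrightarrow> (q @ a # w) ! m \<noteq> (q @ a # w) ! 0"
      proof (intro allI impI)
        fix m assume m: "Suc j \<le> m \<and> m \<le> Suc (length u)"
        then show "(q @ a # w) ! m \<noteq> (q @ a # w) ! 0"
          using no[of "m - 1"] q by (cases m) auto
      qed
    qed (use j l q in \<open>auto simp: nth_append\<close>)
    then show False using Cons.prems by simp
  qed
  have nn: "\<not> nesting (remove1 a q @ a # w)"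
  proof (cases "a \<in> set q")
    case True
    with hd obtain u where q: "q = a # u" by (cases q) auto
    then show ?thesis using nesting_append[of "u @ a # w" "[a]"] Cons.prems(2) by auto
  next
    case False
    then show ?thesis using Cons.prems(2) by (simp add: remove1_idem)
  qed
  have "\<not> nesting (q' @ w)"
  proof (cases "1 < r a")
    case True
    then show ?thesis using nn by (simp add: q'_def)
  next
    case False
    then have "a \<notin> set w" using ra by (simp add: count_eq_zero_iff)
    moreover have "a \<notin> set (remove1 a q)" using Cons.prems(1) by (simp add: valid_queue_def)
    ultimately show ?thesis using nn nesting_insert_fresh[of "remove1 a q" w a] False by (auto simp: q'_def)
  qed
  then have "fifo q' r' w"
    using Cons.IH cw valid_queue_step[OF Cons.prems(1)] unfolding q'_def r'_def by blast
  then show ?case using hd ra by (auto simp: q'_def r'_def)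
qed

section \<open>Choosing costs for a queue word\<close>

lemma step_cost_fresh: "a \<notin> set w \<Longrightarrow> step_cost (y(a := t)) w k = step_cost y w k" if "k < length w"
  using that by (auto simp: step_cost_def dest: nth_mem)

text \<open>\<open>t\<close> prescribes the cost of the next occurrence of each queued letter, \<open>T\<close> is the cost of
  the step made last.\<close>

lemma fifo_imp_realizes_from:
  assumes "fifo q r w" "valid_queue q r"
    and "sorted_wrt (\<lambda>i j. t i < t j) q" "\<And>i. i \<in> set q \<Longrightarrow> T < t i \<and> t i \<le> T + 1"
  shows "\<exists>y. (\<forall>i\<in>set q. y i = t i) \<and> realizes y w \<and> (\<forall>k<length w. T < step_cost y w k)"
  using assms
proof (induction w arbitrary: q r t T)
  case Nil
  then show ?case by (intro exI[of _ t]) simp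
next
  case (Cons a w)
  define r' where "r' = r(a := r a - 1)"
  define q' where "q' = remove1 a q @ (if 1 < r a then [a] else [])"
  have fifo': "fifo q' r' w" using Cons.prems(1) by (simp add: q'_def r'_def)
  have ra: "0 < r a" using Cons.prems(1) by simp
  have valid': "valid_queue q' r'" unfolding q'_def r'_def by (rule valid_queue_step) fact
  have dist: "distinct q" using Cons.prems(2) by (simp add: valid_queue_def)
  \<comment> \<open>The cost of the present step. A queued letter has it prescribed; a new letter
    may take any value above \<open>T\<close> and below all queued costs, and the midpoint up to the
    cheapest of these, the head, is one. With nothing queued \<open>T + 1\<close> will do.\<close>
  define T' where "T' = (if a \<in> set q then t a else if q = [] then T + 1 else (T + t (hd q)) / 2)"
  define t' where "t' = t(a := T' + 1)"
  have hd_min: "t (hd q) \<le> t i" if "i \<in> set q" for i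
    using that Cons.prems(3) by (cases q) auto
  have T': "T < T'" "T' \<le> T + 1"
    using Cons.prems(4)[of a] Cons.prems(4)[of "hd q"] by (auto simp: T'_def field_simps)
  have T'_less: "T' < t i" if "i \<in> set (remove1 a q)" for i
  proof (cases "a \<in> set q")
    case True
    then obtain u where "q = a # u" using Cons.prems(1) by (cases q) auto
    then show ?thesis using that Cons.prems(3) by (simp add: T'_def)
  next
    case False
    then have "i \<in> set q" "q \<noteq> []" using that by (auto simp: remove1_idem)
    then show ?thesis
      using False Cons.prems(4)[of i] hd_min[of i] by (simp add: T'_def field_simps)
  qed
  have t'_eq: "t' i = t i" if "i \<in> set (remove1 a q)" for i
    using that dist by (auto simp: t'_def)
  have sub: "i \<in> set q" if "i \<in> set (remove1 a q)" for i 
    using that set_remove1_subset by fast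
  have sorted_rm: "sorted_wrt (\<lambda>i j. t i < t j) (remove1 a q)"
  proof (cases "a \<in> set q")
    case True
    then obtain u where "q = a # u" using Cons.prems(1) by (cases q) auto
    then show ?thesis using Cons.prems(3) by simp
  next
    case False
    then show ?thesis using Cons.prems(3) by (simp add: remove1_idem)
  qed
  have "sorted_wrt (\<lambda>i j. t' i < t' j) (remove1 a q)"
    using sorted_rm by (rule sorted_wrt_mono_rel[rotated]) (simp add: t'_eq)
  \<comment> \<open>Here the window of length 1 pays off: queued costs are at most
    \<open>T + 1\<close>, while the next \<open>a\<close> costs \<open>T' + 1 > T + 1\<close>, so
    \<open>a\<close> correctly rejoins at the rear.\<close>
  moreover have "t' i < t' a" if "i \<in> set (remove1 a q)" for i
    using t'_eq[OF that] Cons.prems(4)[OF sub[OF that]] T' by (simp add: t'_def)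
  ultimately have sorted': "sorted_wrt (\<lambda>i j. t' i < t' j) q'"
    by (auto simp: q'_def sorted_wrt_append)
  have bounds': "T' < t' i \<and> t' i \<le> T' + 1" if "i \<in> set q'" for i
  proof (cases "i \<in> set (remove1 a q)")
    case True
    then show ?thesis using t'_eq T'_less sub Cons.prems(4)[of i] T' by force
  next
    case False
    then have "i = a" using that by (auto simp: q'_def split: if_splits)
    then show ?thesis by (simp add: t'_def)
  qed
  obtain y where y: "\<forall>i\<in>set q'. y i = t' i" "realizes y w" "\<forall>k<length w. T' < step_cost y w k"
    using Cons.IH[OF fifo' valid' sorted' bounds'] by blast
  \<comment> \<open>The vector \<open>y\<close> serves the word after the step \<open>a\<close>. If
    \<open>a\<close> recurs, then \<open>y a = T' + 1\<close> and undoing the shift gives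
    \<open>T'\<close>; otherwise the value at \<open>a\<close> does not enter the remaining costs
    and can be reset.\<close>
  define y' where "y' = y(a := T')"
  have "step_cost (y'(a := y' a + 1)) w k = step_cost y w k" if "k < length w" for k
  proof (cases "1 < r a")
    case True
    then have "y a = T' + 1" using y(1) by (simp add: q'_def t'_def)
    then have "y'(a := y' a + 1) = y" by (auto simp: y'_def)
    then show ?thesis by simp
  next
    case False
    then have "count (mset w) a = 0" using fifo_imp_count[OF fifo', of a] by (simp add: r'_def)
    then have "a \<notin> set w" by (simp add: count_eq_zero_iff)
    then show ?thesis using that by (simp add: step_cost_fresh y'_def)
  qed
  then have "realizes y' (a # w)" "\<forall>k<length (a # w). T < step_cost y' (a # w) k"
    using y T' unfolding realizes_Cons
    by (auto simp: realizes_def y'_def All_less_Suc2 intro: less_trans)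
  moreover have "y' i = t i" if "i \<in> set q" for i
  proof (cases "i = a")
    case True
    then show ?thesis using that by (simp add: y'_def T'_def)
  next
    case False
    then show ?thesis using that y(1) t'_eq[of i] by (simp add: y'_def q'_def)
  qed
  ultimately show ?case by blast
qed

lemma fifo_imp_realizes:
  assumes "fifo [] r w" shows "\<exists>y. realizes y w"
  \<comment> \<open>The empty queue prescribes no cost, so \<open>t\<close> is arbitrary, and
    \<open>0\<close> is an arbitrary cost for a fictitious previous step.\<close>
  using fifo_imp_realizes_from[OF assms, of undefined 0] by (auto simp: valid_queue_def)

lemma fifo_iff_not_nesting:
  "fifo [] r w \<longleftrightarrow> (\<forall>i. count (mset w) i = r i) \<and> \<not> nesting w"
  using fifo_imp_realizes realizes_imp_not_nesting fifo_imp_count not_nesting_imp_fifo[of "[]" r w]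
  by (auto simp: valid_queue_def)

text \<open>With \<open>m = sum r (set q)\<close> pending occurrences, \<open>s\<close> unused letters and \<open>L\<close> remaining
  positions this is the ballot count \<open>(m + 1) * L! / (L + 1 - s)!\<close>.\<close>

lemma card_fifo:
  fixes r :: "'a::finite \<Rightarrow> nat"
  assumes "valid_queue q r"
  shows "finite {w. fifo q r w} \<and>
    card {w. fifo q r w} * fact (Suc (sum r UNIV) - card {i. 0 < r i \<and> i \<notin> set q})
      = Suc (sum r (set q)) * fact (sum r UNIV)"
  using assms
proof (induction "sum r UNIV" arbitrary: q r)
  case 0
  then have r: "r i = 0" for i by simp
  then have "q = []" using 0 by (cases q) (auto simp: valid_queue_def)
  moreover have "{w. fifo q r w} = {[]}"
  proof (intro set_eqI)
    show "w \<in> {w. fifo q r w} \<longleftrightarrow> w \<in> {[]}" for w using r by (cases w) auto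
  qed
  ultimately have "finite {w. fifo q r w}" "card {w. fifo q r w} = 1" by simp_all
  moreover have "sum r UNIV = 0" "sum r (set q) = 0" "{i. 0 < r i \<and> i \<notin> set q} = {}"
    using r by auto
  ultimately show ?case by (simp only:) simp
next
  case (Suc L)
  define S where "S = {i. 0 < r i \<and> i \<notin> set q}"
  define H where "H = (if q = [] then {} else {hd q})"
  define qq where "qq a = remove1 a q @ (if 1 < r a then [a] else [])" for a
  define rr where "rr a = r(a := r a - 1)" for a
  define N where "N a = {w. fifo (qq a) (rr a) w}" for a
  have dist: "distinct q" and pos: "\<And>i. i \<in> set q \<Longrightarrow> 0 < r i"
    using Suc.prems by (auto simp: valid_queue_def)
  have H_sub: "H \<subseteq> set q" by (simp add: H_def)
  have eq: "{w. fifo q r w} = (\<Union>a\<in>H \<union> S. (#) a ` N a)"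
  proof (intro set_eqI iffI)
    fix w assume "w \<in> {w. fifo q r w}"
    moreover have "w \<noteq> []" using calculation Suc.hyps(2) by auto
    then obtain a u where w: "w = a # u" by (cases w) auto
    ultimately have "0 < r a" "a \<in> set q \<longrightarrow> a = hd q" "u \<in> N a"
      by (auto simp: N_def qq_def rr_def)
    then have "a \<in> H \<union> S" by (auto simp: H_def S_def)
    with \<open>u \<in> N a\<close> w show "w \<in> (\<Union>a\<in>H \<union> S. (#) a ` N a)" by blast
  next
    fix w assume "w \<in> (\<Union>a\<in>H \<union> S. (#) a ` N a)"
    then obtain a w' where "w = a # w'" "a \<in> H \<union> S" "w' \<in> N a" by auto
    moreover have "0 < r a" "a \<in> set q \<longrightarrow> a = hd q"
      using \<open>a \<in> H \<union> S\<close> pos[of a] H_sub by (auto simp: S_def H_def split: if_splits)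
    ultimately show "w \<in> {w. fifo q r w}" by (simp add: N_def qq_def rr_def)
  qed
  have rr_sum: "sum (rr a) UNIV = L" if "0 < r a" for a
  proof -
    have "sum (rr a) UNIV = (r a - 1) + sum r (UNIV - {a})"
      by (subst sum.remove[of _ a]) (auto simp: rr_def intro!: sum.cong)
    then show ?thesis using Suc.hyps(2) that by (simp add: sum.remove[of _ a r])
  qed
  have IH: "finite (N a)"
    "card (N a) * fact (Suc L - card {i. 0 < rr a i \<and> i \<notin> set (qq a)}) = Suc (sum (rr a) (set (qq a))) * fact L"
    if "0 < r a" for a
    using Suc.hyps(1)[of "rr a" "qq a"] rr_sum[OF that] valid_queue_step[OF Suc.prems, of a]
    unfolding N_def qq_def rr_def by auto
  have posHS: "0 < r a" if "a \<in> H \<union> S" for a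
    using that pos H_sub by (auto simp: S_def)
  have fin: "finite {w. fifo q r w}" unfolding eq using IH(1) posHS by auto
  have "card {w. fifo q r w} = (\<Sum>a\<in>H \<union> S. card (N a))"
    unfolding eq
    using card_UN_disjoint[of "H \<union> S" "\<lambda>a. (#) a ` N a"] IH(1) posHS by (auto simp: card_image)
  also have "\<dots> = (\<Sum>a\<in>H. card (N a)) + (\<Sum>a\<in>S. card (N a))"
    using H_sub by (intro sum.union_disjoint) (auto simp: S_def)
  finally have card: "card {w. fifo q r w} = (\<Sum>a\<in>H. card (N a)) + (\<Sum>a\<in>S. card (N a))" .
  have "card S \<le> (\<Sum>i\<in>S. r i)"
    using sum_mono[of S "\<lambda>_. 1" r] by (auto simp: S_def Suc_le_eq)
  moreover have sumS: "sum r UNIV = sum r (set q) + sum r S"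
  proof -
    have "sum r UNIV = sum r (set q \<union> S)"
      by (rule sum.mono_neutral_right) (auto simp: S_def)
    then show ?thesis by (subst (asm) sum.union_disjoint) (auto simp: S_def)
  qed
  \<comment> \<open>Keeps the natural-number subtractions in the factorials from being
    truncated.\<close>
  ultimately have le: "card S \<le> Suc L" using Suc.hyps(2) by simp
  \<comment> \<open>Serving a pending letter lowers the number of pending occurrences by 1, and
    opening \<open>a\<close> adds \<open>r a - 1\<close>; the \<open>Suc\<close> of the ballot
    numerator absorbs this 1 in both cases.\<close>
  have sum_qq: "Suc (sum (rr a) (set (qq a))) = sum r (set q) + (if a \<in> set q then 0 else r a)"
    if "0 < r a" for a
  proof -
    have "sum (rr a) (set (qq a)) = sum (rr a) (insert a (set q))"
    proof (rule sum.mono_neutral_left)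
      show "set (qq a) \<subseteq> insert a (set q)" using dist by (auto simp: qq_def)
      show "\<forall>i\<in>insert a (set q) - set (qq a). rr a i = 0"
        using dist by (auto simp: qq_def rr_def)
    qed simp
    also have "\<dots> = (r a - 1) + sum r (set q - {a})"
      by (subst sum.insert_remove) (auto simp: rr_def intro!: sum.cong)
    finally show ?thesis using that by (auto simp: sum.remove[of "set q" a r])
  qed
  have new: "{i. 0 < rr a i \<and> i \<notin> set (qq a)} = S - {a}" if "0 < r a" for a
    using dist by (auto simp: S_def qq_def rr_def split: if_splits)
  have cardH: "(\<Sum>a\<in>H. card (N a)) * fact (Suc L - card S) = sum r (set q) * fact L"
  proof (cases "q = []")
    case False
    then have h: "hd q \<in> set q" "0 < r (hd q)" using pos by auto
    then have "S - {hd q} = S" by (auto simp: S_def)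
    then show ?thesis
      using IH(2)[of "hd q"] new[of "hd q"] sum_qq[of "hd q"] h False by (simp add: H_def)
  qed (simp add: H_def)
  have cardS: "card (N a) * fact (Suc (Suc L) - card S) = (sum r (set q) + r a) * fact L" if "a \<in> S" for a
  proof -
    have "0 < r a" "a \<notin> set q" using that by (auto simp: S_def)
    moreover have "Suc L - (card S - 1) = Suc (Suc L) - card S"
      using that by (cases "card S") (auto simp: card_eq_0_iff)
    ultimately show ?thesis using IH(2)[of a] new[of a] sum_qq[of a] that
      by (simp add: card_Diff_singleton)
  qed
  have "card {w. fifo q r w} * fact (Suc (Suc L) - card S)
     = (Suc (Suc L) - card S) * ((\<Sum>a\<in>H. card (N a)) * fact (Suc L - card S))
       + (\<Sum>a\<in>S. card (N a) * fact (Suc (Suc L) - card S))"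
  proof -
    have "fact (Suc (Suc L) - card S) = (Suc (Suc L) - card S) * fact (Suc L - card S)"
      using le by (simp add: Suc_diff_le)
    then have "x * fact (Suc (Suc L) - card S) = (Suc (Suc L) - card S) * (x * fact (Suc L - card S))" for x
      by simp
    then show ?thesis unfolding card by (simp only: distrib_left distrib_right sum_distrib_left sum_distrib_right)
  qed
  also have "\<dots> = (Suc (Suc L) - card S) * (sum r (set q) * fact L) + (\<Sum>a\<in>S. (sum r (set q) + r a) * fact L)"
    unfolding cardH using cardS by simp
  also have "(\<Sum>a\<in>S. (sum r (set q) + r a) * fact L) = (card S * sum r (set q) + sum r S) * fact L"
    by (simp add: sum_distrib_right[symmetric] sum.distrib)
  also have "(Suc (Suc L) - card S) * (sum r (set q) * fact L) + (card S * sum r (set q) + sum r S) * fact L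
     = ((Suc (Suc L) - card S + card S) * sum r (set q) + sum r S) * fact L"
    by (simp only: algebra_simps)
  \<comment> \<open>With \<open>m\<close> occurrences pending,
    \<open>(L + 2) m + (L + 1 - m) = (m + 1) (L + 1)\<close>.\<close>
  also have "\<dots> = Suc (sum r (set q)) * fact (Suc L)"
  proof -
    have "Suc L = sum r (set q) + sum r S" using sumS Suc.hyps(2) by simp
    moreover have "Suc (Suc L) - card S + card S = Suc (Suc L)" using le by simp
    ultimately have "(Suc (Suc L) - card S + card S) * sum r (set q) + sum r S = Suc (sum r (set q)) * Suc L"
      by simp
    then show ?thesis by (simp only: fact_Suc mult.assoc of_nat_id)
  qed
  finally show ?case using fin unfolding S_def Suc.hyps(2)[symmetric] by blast
qed

subsection \<open>Words and regions\<close>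

definition generic :: "('a \<Rightarrow> nat) \<Rightarrow> ('a \<Rightarrow> real) \<Rightarrow> bool" where
  "generic r y \<longleftrightarrow> (\<forall>i j p q. i \<noteq> j \<longrightarrow> p < r i \<longrightarrow> q < r j \<longrightarrow> y i + real p \<noteq> y j + real q)"

lemma realizes_imp_generic:
  assumes "realizes y w" "\<And>i. count (mset w) i = r i"
  shows "generic r y"
  unfolding generic_def
proof (intro allI impI)
  fix i j p q assume "i \<noteq> j" "p < r i" "q < r j"
  then obtain k l where kl: "k < length w" "w ! k = i" "count (mset (take k w)) i = p"
    "l < length w" "w ! l = j" "count (mset (take l w)) j = q"
    using occurrence_position[of p "length w" w i] occurrence_position[of q "length w" w j] assms(2)
    by auto
  then have "step_cost y w k = y i + real p" "step_cost y w l = y j + real q"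
    by (simp_all add: step_cost_def)
  moreover have "k \<noteq> l" using kl \<open>i \<noteq> j\<close> by auto
  then have "step_cost y w k \<noteq> step_cost y w l"
    using assms(1) kl unfolding realizes_def by (metis linorder_neqE_nat less_irrefl)
  ultimately show "y i + real p \<noteq> y j + real q" by simp
qed

text \<open>The realized word is built greedily, by always advancing the cheapest letter.\<close>

lemma generic_imp_realizes:
  fixes r :: "'a::finite \<Rightarrow> nat"
  assumes "generic r y"
  shows "\<exists>w. (\<forall>i. count (mset w) i = r i) \<and> realizes y w"
  using assms
proof (induction "sum r UNIV" arbitrary: r y)
  case 0
  then show ?case by (intro exI[of _ "[]"]) simp
next
  case (Suc L)
  define I where "I = {i. 0 < r i}"
  have "I \<noteq> {}"
  proof
    assume "I = {}"
    then have "sum r UNIV = 0" by (simp add: I_def)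
    with Suc.hyps(2) show False by simp
  qed
  then obtain a where a: "a \<in> I" "\<And>i. i \<in> I \<Longrightarrow> y a \<le> y i"
    using arg_min_if_finite[of I y] by (metis finite not_le)
  define r' where "r' = r(a := r a - 1)"
  define y' where "y' = y(a := y a + 1)"
  have ra: "0 < r a" using a by (simp add: I_def)
  have "sum r UNIV = r a + sum r (UNIV - {a})" "sum r' UNIV = (r a - 1) + sum r (UNIV - {a})"
    by (simp_all add: sum.remove[of UNIV a] r'_def)
  then have sum': "L = sum r' UNIV" using Suc.hyps(2) ra by simp
  have "generic r' y'"
    unfolding generic_def
  proof (intro allI impI)
    fix i j p q assume "i \<noteq> j" "p < r' i" "q < r' j"
    then show "y' i + real p \<noteq> y' j + real q"
      using Suc.prems[unfolded generic_def, rule_format, of i j "if i = a then Suc p else p" "if j = a then Suc q else q"]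
      unfolding r'_def y'_def by (cases "i = a"; cases "j = a") (simp_all add: less_diff_conv)
  qed
  from Suc.hyps(1)[OF sum' this] obtain w where w: "\<forall>i. count (mset w) i = r' i" "realizes y' w"
    by blast
  have "y a < step_cost y' w k" if "k < length w" for k
  proof -
    have "0 < count (mset w) (w ! k)" using that by simp
    then have pos: "0 < r' (w ! k)" using w(1) by simp
    have "y a < y' (w ! k)"
    proof (cases "w ! k = a")
      case False
      then have "y a \<noteq> y (w ! k)" "w ! k \<in> I"
        using Suc.prems[unfolded generic_def, rule_format, of a "w ! k" 0 0] pos ra
        by (auto simp: r'_def I_def)
      then show ?thesis using a(2)[of "w ! k"] False by (simp add: y'_def)
    qed (simp add: y'_def)
    then show ?thesis by (simp add: step_cost_def)
  qed
  then have "realizes y (a # w)" using w(2) by (simp add: realizes_Cons y'_def)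
  moreover have "count (mset (a # w)) i = r i" for i using w(1) ra by (auto simp: r'_def)
  ultimately show ?case by blast
qed

text \<open>A coincidence \<open>x $ i + p = x $ j + q\<close> lies on the hyperplane with
  \<open>m = q - p\<close>, and the ranges of \<open>p\<close> and \<open>q\<close> give exactly the
  range of \<open>m\<close>. Conversely, each \<open>m\<close> arises with \<open>p = 0\<close> or
  \<open>q = 0\<close> according to its sign; this pair is admissible because the multiplicities are
  positive.\<close>

lemma generic_iff_arrangement:
  fixes lam :: "'d::{finite,linorder} \<Rightarrow> nat"
  assumes pos: "\<And>i. 0 < lam i"
  shows "generic lam (($) x) \<longleftrightarrow> x \<notin> \<Union>(arrangement lam)"
proof
  assume gen: "generic lam (($) x)"
  show "x \<notin> \<Union>(arrangement lam)"
  proof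
    assume "x \<in> \<Union>(arrangement lam)"
    then obtain i j m where ij: "i < j" "- int (lam i) + 1 \<le> m" "m \<le> int (lam j) - 1"
      and eq: "x $ i - x $ j = real_of_int m"
      unfolding arrangement_def by blast
    show False
    proof (cases "0 \<le> m")
      case True
      then have "x $ i + real 0 = x $ j + real (nat m)" using eq by simp
      moreover have "0 < lam i" "nat m < lam j" using True ij pos by auto
      ultimately show False
        using gen[unfolded generic_def, rule_format, of i j 0 "nat m"] ij(1) by blast
    next
      case False
      then have "x $ i + real (nat (- m)) = x $ j + real 0" using eq by simp
      moreover have "nat (- m) < lam i" "0 < lam j" using False ij pos by auto
      ultimately show False
        using gen[unfolded generic_def, rule_format, of i j "nat (- m)" 0] ij(1) by blast
    qed
  qed
next
  assume notin: "x \<notin> \<Union>(arrangement lam)"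
  have "x $ i + real p \<noteq> x $ j + real q" if "i < j" "p < lam i" "q < lam j" for i j p q
  proof
    assume "x $ i + real p = x $ j + real q"
    then have "x $ i - x $ j = real_of_int (int q - int p)" by simp
    moreover have "- int (lam i) + 1 \<le> int q - int p" "int q - int p \<le> int (lam j) - 1"
      using that by linarith+
    ultimately have "x \<in> \<Union>(arrangement lam)" using that(1) unfolding arrangement_def by blast
    with notin show False ..
  qed
  then show "generic lam (($) x)"
    unfolding generic_def by (metis linorder_neqE)
qed

definition words :: "('d::finite \<Rightarrow> nat) \<Rightarrow> 'd list set" where
  "words lam = {w. lambda_permutation lam w \<and> \<not> nesting w}"

lemma words_iff_realizes:
  "w \<in> words lam \<longleftrightarrow> lambda_permutation lam w \<and> (\<exists>y::real^'d. realizes (($) y) w)"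
  for lam :: "'d::finite \<Rightarrow> nat"
proof -
  have "(\<exists>y::real^'d. realizes (($) y) w)" if "realizes y w" for y
    using that by (intro exI[of _ "\<chi> i. y i"]) (simp add: vec_lambda_inverse)
  then show ?thesis
    unfolding words_def lambda_permutation_def
    using fifo_iff_not_nesting[of lam w] fifo_imp_realizes[of lam w] realizes_imp_not_nesting
    by blast
qed

lemma card_words:
  assumes "composition lam n"
  shows "finite (words lam)" "real (card (words (lam :: 'd::finite \<Rightarrow> nat))) = fact n / fact (n - CARD('d) + 1)"
proof -
  have eq: "words lam = {w. fifo [] lam w}"
    unfolding words_def lambda_permutation_def fifo_iff_not_nesting ..
  have lam: "\<And>i. 0 < lam i" "sum lam UNIV = n" using assms by (auto simp: composition_def)
  have vq: "valid_queue [] lam" by (simp add: valid_queue_def)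
  show "finite (words lam)" using card_fifo[OF vq] eq by simp
  have "CARD('d) \<le> n" using sum_mono[of UNIV "\<lambda>_. 1" lam] lam by (simp add: Suc_le_eq)
  then have "card (words lam) * fact (n - CARD('d) + 1) = fact n"
    using card_fifo[OF vq] eq lam by (simp add: Suc_diff_le)
  then have "real (card (words lam)) * fact (n - CARD('d) + 1) = fact n"
    by (metis of_nat_fact of_nat_mult)
  then show "real (card (words lam)) = fact n / fact (n - CARD('d) + 1)"
    by (simp add: field_simps del: fact_Suc)
qed

section \<open>Chambers of realizing vectors\<close>

definition chamber :: "'d::finite list \<Rightarrow> (real ^ 'd) set" where
  "chamber w = {x. realizes (($) x) w}"

lemma chamber_eq:
  "chamber w = (\<Inter>(j, k)\<in>{(j, k). j < k \<and> k < length w}. {x. step_cost (($) x) w j < step_cost (($) x) w k})"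
  by (auto simp: chamber_def realizes_def)

lemma open_chamber: "open (chamber w)"
proof -
  have "finite {(j, k). j < k \<and> k < length w}"
    by (rule finite_subset[of _ "{..<length w} \<times> {..<length w}"]) auto
  moreover have "open {x. step_cost (($) x) w j < step_cost (($) x) w k}" for j k
    unfolding step_cost_def by (intro open_Collect_less continuous_intros)
  ultimately show ?thesis
    unfolding chamber_eq by (intro open_INT) auto
qed

lemma convex_chamber: "convex (chamber w)"
proof (rule convexI)
  fix x y :: "real ^ 'a" and u v :: real
  assume H: "x \<in> chamber w" "y \<in> chamber w" "0 \<le> u" "0 \<le> v" "u + v = 1"
  \<comment> \<open>The cost is affine, not linear, in the vector: its integer part must be split
    between the two terms by \<open>u + v = 1\<close>.\<close>
  have comb: "step_cost (($) (u *\<^sub>R x + v *\<^sub>R y)) w k = u * step_cost (($) x) w k + v * step_cost (($) y) w k" for k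
  proof -
    have "real (count (mset (take k w)) (w ! k)) = (u + v) * real (count (mset (take k w)) (w ! k))"
      using H by simp
    then show ?thesis by (simp add: step_cost_def algebra_simps)
  qed
  have "realizes (($) (u *\<^sub>R x + v *\<^sub>R y)) w"
    unfolding realizes_def comb
  proof (intro allI impI)
    fix j k assume "j < k" "k < length w"
    then have "step_cost (($) x) w j < step_cost (($) x) w k" "step_cost (($) y) w j < step_cost (($) y) w k"
      using H by (auto simp: chamber_def realizes_def)
    moreover have "0 < u \<or> 0 < v" using H by linarith
    ultimately show "u * step_cost (($) x) w j + v * step_cost (($) y) w j
        < u * step_cost (($) x) w k + v * step_cost (($) y) w k"
      using H(3,4)
      by (metis add_less_le_mono add_le_less_mono less_imp_le mult_left_mono mult_strict_left_mono)
  qed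
  then show "u *\<^sub>R x + v *\<^sub>R y \<in> chamber w" by (simp add: chamber_def)
qed

text \<open>A realized word starts with the strictly cheapest of its letters, so \<open>y\<close>
  and the multiset determine the first letter; the shifted \<open>y\<close> determines the
  rest.\<close>

lemma realizes_unique:
  assumes "realizes y w" "realizes y w'" "mset w = mset w'"
  shows "w = w'"
  using assms
proof (induction w arbitrary: w' y)
  case Nil
  then show ?case by simp
next
  case (Cons a u)
  then obtain b v where w': "w' = b # v" by (cases w') auto
  have least: "y c < y d" if "realizes y (c # s)" "d \<in> set (c # s)" "d \<noteq> c" for c d s
  proof -
    have "0 < count (mset (take (length (c # s)) (c # s))) d"
      using that(2) by (metis count_greater_zero_iff order_refl set_mset_mset take_all)
    then obtain j where j: "j < length (c # s)" "(c # s) ! j = d" "count (mset (take j (c # s))) d = 0"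
      using occurrence_position[of 0 "length (c # s)" "c # s" d] by blast
    moreover have "0 < j" using j that(3) by (cases j) auto
    ultimately have "step_cost y (c # s) 0 < step_cost y (c # s) j"
      using that(1) unfolding realizes_def by blast
    also have "step_cost y (c # s) j = y d" unfolding step_cost_def j by simp
    finally show ?thesis by simp
  qed
  have "set (a # u) = set (b # v)" using Cons.prems(3) w' by (metis set_mset_mset)
  then have "b \<in> set (a # u)" "a \<in> set (b # v)" by auto
  then have "a = b"
    using least[of a u b] least[of b v a] Cons.prems(1,2) unfolding w' by force
  then show ?case using Cons.IH[of _ v] Cons.prems w' by (auto simp: realizes_Cons)
qed

text \<open>The chambers are open, connected because convex, disjoint by uniqueness of the realized
  word, and they cover the complement of the arrangement; such a family is the family of
  components.\<close>

lemma chamber_regions: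
  fixes lam :: "'d::{finite,linorder} \<Rightarrow> nat"
  assumes "\<And>i. 0 < lam i"
  shows "regions (arrangement lam) = chamber ` words lam" "inj_on chamber (words lam)"
proof -
  have disj: "w = w'" if "w \<in> words lam" "w' \<in> words lam" "x \<in> chamber w" "x \<in> chamber w'" for w w' x
    using that realizes_unique[of "($) x" w w']
    by (auto simp: chamber_def words_def lambda_permutation_def multiset_eq_iff)
  have nonempty: "chamber w \<noteq> {}" if "w \<in> words lam" for w
    using that by (auto simp: words_iff_realizes chamber_def)
  show "inj_on chamber (words lam)"
    using disj nonempty by (intro inj_onI) blast
  have "\<Union>(chamber ` words lam) = - \<Union>(arrangement lam)"
  proof (intro set_eqI)
    fix x :: "(real, 'd) vec"
    have "x \<in> \<Union>(chamber ` words lam) \<longleftrightarrow> (\<exists>w. lambda_permutation lam w \<and> realizes (($) x) w)"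
      using words_iff_realizes[of _ lam] by (auto simp: chamber_def)
    also have "\<dots> \<longleftrightarrow> generic lam (($) x)"
      using realizes_imp_generic[of "($) x" _ lam] generic_imp_realizes[of lam "($) x"]
      by (auto simp: lambda_permutation_def)
    also have "\<dots> \<longleftrightarrow> x \<in> - \<Union>(arrangement lam)"
      using generic_iff_arrangement[OF assms] by simp
    finally show "x \<in> \<Union>(chamber ` words lam) \<longleftrightarrow> x \<in> - \<Union>(arrangement lam)" .
  qed
  moreover have "pairwise disjnt (chamber ` words lam)"
    using disj by (fastforce simp: pairwise_def disjnt_def)
  ultimately show "regions (arrangement lam) = chamber ` words lam"
    unfolding regions_def
    by (intro components_open_unique) (auto simp: open_chamber convex_connected convex_chamber nonempty)
qed

subsection \<open>Edges along a realizable path\<close>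

text \<open>Transfers minimization from lattice points to \<open>lifted_polytope\<close>: a convex
  combination attains the lower bound only if every generator of positive weight does.\<close>

lemma convex_hull_minimizers:
  fixes f :: "'a::real_vector \<Rightarrow> real"
  assumes "linear f" "\<And>x. x \<in> X \<Longrightarrow> m \<le> f x" "z \<in> convex hull X"
  shows "m \<le> f z" "f z = m \<Longrightarrow> z \<in> convex hull {x \<in> X. f x = m}"
proof -
  define Y where "Y = convex hull {x \<in> X. f x = m}"
  \<comment> \<open>Combines both claims into one convex set containing \<open>X\<close>, so that a
    single appeal to minimality of the hull proves them.\<close>
  define C where "C = {z. m \<le> f z \<and> (f z = m \<longrightarrow> z \<in> Y)}"
  have "convex C"
  proof (rule convexI)
    fix z1 z2 and u v :: real
    assume H: "z1 \<in> C" "z2 \<in> C" "0 \<le> u" "0 \<le> v" "u + v = 1"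
    have f: "f (u *\<^sub>R z1 + v *\<^sub>R z2) - m = u * (f z1 - m) + v * (f z2 - m)"
    proof -
      have "m = (u + v) * m" using H by simp
      then show ?thesis
        using assms(1) by (simp add: linear_add linear_scale algebra_simps)
    qed
    have nonneg: "0 \<le> u * (f z1 - m)" "0 \<le> v * (f z2 - m)"
      using H by (auto simp: C_def)
    have "u *\<^sub>R z1 + v *\<^sub>R z2 \<in> Y" if "f (u *\<^sub>R z1 + v *\<^sub>R z2) = m"
    proof -
      have zero: "u * (f z1 - m) = 0" "v * (f z2 - m) = 0"
        using f nonneg that by linarith+
      consider "u = 0" | "v = 0" | "f z1 = m" "f z2 = m" using zero by auto
      then show ?thesis
      proof cases
        case 1
        then show ?thesis using H zero by (simp add: C_def)
      next
        case 2
        then show ?thesis using H zero by (simp add: C_def)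
      next
        case 3
        then have "z1 \<in> Y" "z2 \<in> Y" using H by (auto simp: C_def)
        moreover have "convex Y" by (simp add: Y_def)
        ultimately show ?thesis using H by (simp add: convexD)
      qed
    qed
    then show "u *\<^sub>R z1 + v *\<^sub>R z2 \<in> C"
      using f nonneg by (simp add: C_def)
  qed
  moreover have "X \<subseteq> C"
    using assms(2) by (auto simp: C_def Y_def intro: hull_inc)
  ultimately have "z \<in> C" using assms(3) hull_minimal by blast
  then show "m \<le> f z" "f z = m \<Longrightarrow> z \<in> convex hull {x \<in> X. f x = m}"
    by (auto simp: C_def Y_def)
qed

lemma linear_minimizers_face_of:
  fixes f :: "'a::euclidean_space \<Rightarrow> real"
  assumes "linear f" "convex P" "\<And>x. x \<in> P \<Longrightarrow> m \<le> f x"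
  shows "{x \<in> P. f x = m} face_of P"
proof -
  have f: "f x = adjoint f 1 \<bullet> x" for x
    using adjoint_works[OF assms(1), of x 1] by (simp add: inner_commute)
  have "P \<inter> {x. adjoint f 1 \<bullet> x = m} face_of P"
    using assms f by (intro face_of_Int_supporting_hyperplane_ge) auto
  then show ?thesis using f by (simp add: Int_def)
qed

text \<open>A unit step in direction \<open>i\<close> from the lift of a lattice point \<open>v\<close> raises \<open>lfun y\<close> by
  \<open>2 * (y i + v $ i)\<close>, twice its step cost.\<close>

definition lfun :: "('d \<Rightarrow> real) \<Rightarrow> (real ^ 'd::finite) \<times> real \<Rightarrow> real" where
  "lfun y z = snd z + (\<Sum>i\<in>UNIV. (2 * y i - 1) * fst z $ i)"

lemma linear_lfun: "linear (lfun y)"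
  unfolding lfun_def
  by (rule linearI) (simp_all add: distrib_left sum.distrib sum_distrib_left mult.left_commute)

lemma linear_height: "linear height"
  unfolding height_def
  by (rule linearI) (simp_all add: sum.distrib sum_distrib_left)

section \<open>Path vertices and heights in the lifted polytope\<close>

lemma path_vertex_nth:
  "k \<le> length w \<Longrightarrow> path_vertex w k $ i = real (count (mset (take k w)) i)"
  by (induction k) (auto simp: count_take_Suc axis_def)

lemma lambda_permutation_length:
  fixes lam :: "'d::finite \<Rightarrow> nat"
  assumes "lambda_permutation lam w" shows "length w = sum lam UNIV"
proof -
  have "length w = (\<Sum>i\<in>set_mset (mset w). count (mset w) i)"
    by (metis size_mset size_multiset_overloaded_eq)
  also have "\<dots> = (\<Sum>i\<in>UNIV. count (mset w) i)"
    by (rule sum.mono_neutral_left) (auto simp: count_eq_zero_iff)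
  finally show ?thesis using assms by (simp add: lambda_permutation_def)
qed

lemma height_lift_path_vertex [simp]: "height (lift_pt (path_vertex w k)) = real k"
  by (induction k) (auto simp: height_def lift_pt_def sum.distrib axis_def)

lemma path_vertex_lattice:
  assumes "lambda_permutation lam w" "k \<le> length w"
  shows "path_vertex w k \<in> lambda_box lam \<inter> lattice_points"
  using assms count_take_le[of k w]
  by (auto simp: lambda_box_def lattice_points_def path_vertex_nth lambda_permutation_def)

lemma lift_lattice_in_polytope:
  "v \<in> lambda_box lam \<inter> lattice_points \<Longrightarrow> lift_pt v \<in> lifted_polytope lam"
  unfolding lifted_polytope_def by (intro hull_inc imageI)

lemma convex_lifted_polytope: "convex (lifted_polytope lam)"
  by (simp add: lifted_polytope_def)

lemma height_bounds:
  assumes "z \<in> lifted_polytope lam"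
  shows "0 \<le> height z" "height z \<le> real (sum lam UNIV)"
proof -
  have *: "0 \<le> height z" "height z \<le> real (sum lam UNIV)"
    if z: "z \<in> lift_pt ` (lambda_box lam \<inter> lattice_points)" for z
  proof -
    show "0 \<le> height z"
      using z by (auto simp: height_def lift_pt_def lambda_box_def intro!: sum_nonneg)
    show "height z \<le> real (sum lam UNIV)"
      unfolding height_def of_nat_sum
      using z by (intro sum_mono) (auto simp: lift_pt_def lambda_box_def)
  qed
  show "0 \<le> height z"
    using convex_hull_minimizers(1)[OF linear_height *(1)] assms unfolding lifted_polytope_def by blast
  have "linear (\<lambda>z. - height z)" by (rule linear_compose_neg[OF linear_height])
  from convex_hull_minimizers(1)[OF this, of "lift_pt ` (lambda_box lam \<inter> lattice_points)" "- real (sum lam UNIV)" z]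
  show "height z \<le> real (sum lam UNIV)"
    using *(2) assms unfolding lifted_polytope_def by auto
qed

text \<open>The Lagrangian of minimizing \<open>lfun y\<close> at fixed height: \<open>2 * t\<close>
  is the price of a unit of height. With \<open>t\<close> the cost of step \<open>k\<close>, both
  ends of that step become global minimizers.\<close>

definition tilted :: "('d \<Rightarrow> real) \<Rightarrow> real \<Rightarrow> (real ^ 'd::finite) \<times> real \<Rightarrow> real" where
  "tilted y t z = lfun y z - 2 * t * height z"

lemma linear_tilted: "linear (tilted y t)"
  unfolding tilted_def
  by (rule linearI) (simp_all add: linear_add[OF linear_lfun] linear_scale[OF linear_lfun]
      linear_add[OF linear_height] linear_scale[OF linear_height] algebra_simps)

text \<open>Separability reduces the comparison to single coordinates, and each difference of
  quadratics factors, so that its sign can be read off.\<close>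

lemma tilted_diff:
  "tilted y t (lift_pt v) - tilted y t (lift_pt u)
     = (\<Sum>i\<in>UNIV. (v $ i - u $ i) * (v $ i + u $ i - 1 + 2 * y i - 2 * t))"
proof -
  have eq: "tilted y t (lift_pt x) = (\<Sum>i\<in>UNIV. (x $ i)\<^sup>2 + (2 * y i - 1) * x $ i - 2 * t * x $ i)" for x
    by (simp add: tilted_def lfun_def lift_pt_def height_def sqsum_def sum.distrib sum_subtractf
        sum_distrib_left)
  show ?thesis
    unfolding eq sum_subtractf[symmetric]
    by (auto intro!: sum.cong simp: algebra_simps power2_eq_square)
qed

lemma Ints_eq_or_apart:
  fixes a b :: real
  assumes "a \<in> \<int>" "b \<in> \<int>"
  shows "a = b \<or> a + 1 \<le> b \<or> b + 1 \<le> a"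
  using assms by (auto elim!: Ints_cases)

text \<open>The summands of \<open>tilted_diff\<close> are nonnegative: at step \<open>k\<close> all cheaper unit
  steps have been taken and all dearer ones have not.\<close>

lemma tilted_lattice:
  fixes lam :: "'d::finite \<Rightarrow> nat"
  assumes w: "lambda_permutation lam w" "realizes y w" "k < length w"
    and v: "v \<in> lambda_box lam \<inter> lattice_points"
  defines "t \<equiv> step_cost y w k"
  shows "tilted y t (lift_pt (path_vertex w k)) \<le> tilted y t (lift_pt v)"
    and "tilted y t (lift_pt v) = tilted y t (lift_pt (path_vertex w k)) \<longleftrightarrow>
      v = path_vertex w k \<or> v = path_vertex w (Suc k)"
proof -
  define u where "u = path_vertex w k"
  define D where "D i = (v $ i - u $ i) * (v $ i + u $ i - 1 + 2 * y i - 2 * t)" for i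
  have u: "u $ i = real (count (mset (take k w)) i)" for i
    using w by (simp add: u_def path_vertex_nth)
  have vb: "0 \<le> v $ i" "v $ i \<le> real (lam i)" "v $ i \<in> \<int>" for i
    using v by (auto simp: lambda_box_def lattice_points_def)
  have t: "t = y (w ! k) + u $ (w ! k)" by (simp add: t_def step_cost_def u)
  \<comment> \<open>By integrality \<open>v $ i + u $ i - 1\<close> is at most
    \<open>2 * (u $ i - 1)\<close> here and at least \<open>2 * u $ i\<close> in
    \<open>above\<close>. These are the values at which the lower and the upper bound on the cost of
    step \<open>k\<close> fix the sign of the second factor.\<close>
  have below: "0 < D i" if "v $ i + 1 \<le> u $ i" for i
  proof -
    have "0 < u $ i" using that vb(1)[of i] by linarith
    then have "y i + u $ i - 1 < t"
      using realizes_lower_bound[OF w(2,3), of i] by (simp add: u t_def)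
    then show ?thesis
      unfolding D_def using that by (intro mult_neg_neg) auto
  qed
  have above: "0 < D i" if "u $ i + 1 \<le> v $ i" "i \<noteq> w ! k" for i
  proof -
    have "u $ i < real (lam i)" using that vb(2)[of i] by linarith
    then have "t < y i + u $ i"
      using realizes_upper_bound[OF w(2,3), of i] that(2) w(1)
      by (simp add: u t_def lambda_permutation_def)
    then show ?thesis
      unfolding D_def using that by (intro mult_pos_pos) auto
  qed
  \<comment> \<open>For the letter being read, \<open>t = y i + u $ i\<close> leaves a product of
    two consecutive integers: never negative, and zero exactly at the two ends of the step.\<close>
  have Dk: "D i = (v $ i - u $ i) * (v $ i - u $ i - 1)" if "i = w ! k" for i
    using that by (simp add: D_def t algebra_simps)
  have cases: "v $ i = u $ i \<or> v $ i + 1 \<le> u $ i \<or> u $ i + 1 \<le> v $ i" for i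
    using Ints_eq_or_apart[OF vb(3)[of i], of "u $ i"] by (auto simp: u)
  have nonneg: "0 \<le> D i" for i
  proof (cases "i = w ! k \<and> u $ i + 1 \<le> v $ i")
    case True
    then show ?thesis using Dk[of i] by (auto intro!: mult_nonneg_nonneg)
  next
    case False
    then have "D i = 0 \<or> 0 < D i" using cases[of i] below[of i] above[of i] by (auto simp: D_def)
    then show ?thesis by auto
  qed
  have diff: "tilted y t (lift_pt v) - tilted y t (lift_pt u) = (\<Sum>i\<in>UNIV. D i)"
    by (simp add: tilted_diff D_def)
  have "0 \<le> (\<Sum>i\<in>UNIV. D i)" using nonneg by (rule sum_nonneg)
  then show "tilted y t (lift_pt (path_vertex w k)) \<le> tilted y t (lift_pt v)"
    using diff by (simp add: u_def)
  have "tilted y t (lift_pt v) = tilted y t (lift_pt u) \<longleftrightarrow> (\<forall>i. D i = 0)"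
    using diff sum_nonneg_eq_0_iff[of UNIV D] nonneg by auto
  also have "\<dots> \<longleftrightarrow> v = u \<or> v = u + axis (w ! k) 1"
  proof
    assume D0: "\<forall>i. D i = 0"
    have other: "v $ i = u $ i" if "i \<noteq> w ! k" for i
      using cases[of i] below[of i] above[of i] that D0[rule_format, of i] by auto
    have "(v $ (w ! k) - u $ (w ! k)) * (v $ (w ! k) - u $ (w ! k) - 1) = 0"
      using D0 Dk[OF refl] by metis
    then have "v $ (w ! k) - u $ (w ! k) = 0 \<or> v $ (w ! k) - u $ (w ! k) - 1 = 0"
      unfolding mult_eq_0_iff .
    then have "v $ (w ! k) = u $ (w ! k) \<or> v $ (w ! k) = u $ (w ! k) + 1" by linarith
    then show "v = u \<or> v = u + axis (w ! k) 1"
    proof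
      assume "v $ (w ! k) = u $ (w ! k)"
      then have "v = u" unfolding vec_eq_iff using other by metis
      then show ?thesis ..
    next
      assume *: "v $ (w ! k) = u $ (w ! k) + 1"
      have "v = u + axis (w ! k) 1"
        unfolding vec_eq_iff
      proof
        show "v $ i = (u + axis (w ! k) 1) $ i" for i
          using * other[of i] by (cases "i = w ! k") (auto simp: axis_def)
      qed
      then show ?thesis ..
    qed
  next
    assume "v = u \<or> v = u + axis (w ! k) 1"
    moreover have "D i = 0" if "v = u + axis (w ! k) 1" for i
      using that Dk[of i] by (cases "i = w ! k") (auto simp: D_def axis_def)
    moreover have "D i = 0" if "v = u" for i using that by (simp add: D_def)
    ultimately show "\<forall>i. D i = 0" by blast
  qed
  finally show "tilted y t (lift_pt v) = tilted y t (lift_pt (path_vertex w k)) \<longleftrightarrow>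
      v = path_vertex w k \<or> v = path_vertex w (Suc k)"
    by (simp add: u_def)
qed

definition path_segment :: "'d::finite list \<Rightarrow> nat \<Rightarrow> ((real ^ 'd) \<times> real) set" where
  "path_segment w k = closed_segment (lift_pt (path_vertex w k)) (lift_pt (path_vertex w (Suc k)))"

text \<open>The only minimizing generators are the two ends of step \<open>k\<close>, so the minimal
  face is the segment between them; this is what makes the step an edge.\<close>

lemma tilted_polytope:
  fixes lam :: "'d::finite \<Rightarrow> nat"
  assumes w: "lambda_permutation lam w" "realizes y w" "k < length w"
  defines "t \<equiv> step_cost y w k"
  defines "m \<equiv> tilted y t (lift_pt (path_vertex w k))"
  shows "z \<in> lifted_polytope lam \<Longrightarrow> m \<le> tilted y t z"
    and "{z \<in> lifted_polytope lam. tilted y t z = m} = path_segment w k"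
proof -
  define X where "X = lift_pt ` (lambda_box lam \<inter> lattice_points)"
  have min: "m \<le> tilted y t x" if "x \<in> X" for x
    using that tilted_lattice(1)[OF w] by (auto simp: X_def t_def m_def)
  have P: "lifted_polytope lam = convex hull X" by (simp add: lifted_polytope_def X_def)
  show "m \<le> tilted y t z" if "z \<in> lifted_polytope lam" for z
    
    using convex_hull_minimizers(1)[of "tilted y t" X m z] linear_tilted min that unfolding P by blast
  have pv: "path_vertex w k \<in> lambda_box lam \<inter> lattice_points"
      "path_vertex w (Suc k) \<in> lambda_box lam \<inter> lattice_points"
    using w path_vertex_lattice[of lam w k] path_vertex_lattice[of lam w "Suc k"] by simp_all
  have "{x \<in> X. tilted y t x = m} = {lift_pt (path_vertex w k), lift_pt (path_vertex w (Suc k))}"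
  proof (intro equalityI subsetI)
    fix x assume "x \<in> {x \<in> X. tilted y t x = m}"
    then obtain v where v: "x = lift_pt v" "v \<in> lambda_box lam \<inter> lattice_points"
      "tilted y t (lift_pt v) = m" by (auto simp: X_def)
    then have "v = path_vertex w k \<or> v = path_vertex w (Suc k)"
      using tilted_lattice(2)[OF w v(2)] unfolding t_def m_def by blast
    then show "x \<in> {lift_pt (path_vertex w k), lift_pt (path_vertex w (Suc k))}"
      using v(1) by blast
  next
    fix x assume "x \<in> {lift_pt (path_vertex w k), lift_pt (path_vertex w (Suc k))}"
    then show "x \<in> {x \<in> X. tilted y t x = m}"
      using tilted_lattice(2)[OF w pv(2)] pv unfolding X_def t_def m_def by blast
  qed
  then have seg: "path_segment w k = convex hull {x \<in> X. tilted y t x = m}"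
    by (simp add: path_segment_def segment_convex_hull)
  show "{z \<in> lifted_polytope lam. tilted y t z = m} = path_segment w k"
  proof
    show "{z \<in> lifted_polytope lam. tilted y t z = m} \<subseteq> path_segment w k"
      using convex_hull_minimizers(2)[of "tilted y t" X m] linear_tilted min unfolding P seg by blast
    have "convex {z. tilted y t z = m}"
      using convex_linear_vimage[OF linear_tilted[of y t] convex_singleton[of m]] by (simp add: vimage_def)
    then have "convex hull {x \<in> X. tilted y t x = m} \<subseteq> {z. tilted y t z = m}"
      by (intro hull_minimal) auto
    moreover have "convex hull {x \<in> X. tilted y t x = m} \<subseteq> convex hull X"
      by (rule hull_mono) auto
    ultimately show "path_segment w k \<subseteq> {z \<in> lifted_polytope lam. tilted y t z = m}"
      unfolding seg P by blast
  qed
qed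

lemma path_segment_edge:
  fixes lam :: "'d::finite \<Rightarrow> nat"
  assumes w: "lambda_permutation lam w" "realizes y w" "k < length w"
  shows "path_segment w k edge_of lifted_polytope lam"
proof -
  have ne: "lift_pt (path_vertex w k) \<noteq> lift_pt (path_vertex w (Suc k))"
    by (metis height_lift_path_vertex n_not_Suc_n of_nat_eq_iff)
  have "aff_dim (path_segment w k) = 1"
    using ne unfolding path_segment_def segment_convex_hull aff_dim_convex_hull aff_dim_2 by simp
  moreover have "path_segment w k face_of lifted_polytope lam"
    unfolding tilted_polytope(2)[OF w, symmetric]
    by (rule linear_minimizers_face_of[OF linear_tilted convex_lifted_polytope])
      (rule tilted_polytope(1)[OF w])
  ultimately show ?thesis by (simp add: edge_of_def)
qed

section \<open>The path as a section over the heights\<close>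

text \<open>The clamped weight of the \<open>k\<close>th increment grows from 0 to 1 while
  \<open>t\<close> runs from \<open>k\<close> to \<open>k + 1\<close>. One closed formula makes
  continuity immediate, and the parameter is the height, as in the definition of
  \<open>monotone_path_polytope\<close>.\<close>

definition path_fun :: "'d::finite list \<Rightarrow> real \<Rightarrow> (real ^ 'd) \<times> real" where
  "path_fun w t = (\<Sum>k<length w. max 0 (min 1 (t - real k)) *\<^sub>R
     (lift_pt (path_vertex w (Suc k)) - lift_pt (path_vertex w k)))"

lemma continuous_on_path_fun: "continuous_on S (path_fun w)"
  unfolding path_fun_def by (intro continuous_intros)

lemma path_fun_eq:
  assumes "k < length w" "real k \<le> t" "t \<le> real k + 1"
  shows "path_fun w t = lift_pt (path_vertex w k)
    + (t - real k) *\<^sub>R (lift_pt (path_vertex w (Suc k)) - lift_pt (path_vertex w k))"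
proof -
  define \<delta> where "\<delta> j = lift_pt (path_vertex w (Suc j)) - lift_pt (path_vertex w j)" for j
  have "path_fun w t = (\<Sum>j<length w. max 0 (min 1 (t - real j)) *\<^sub>R \<delta> j)"
    by (simp add: path_fun_def \<delta>_def)
  also have "\<dots> = (\<Sum>j<Suc k. max 0 (min 1 (t - real j)) *\<^sub>R \<delta> j)"
  proof (rule sum.mono_neutral_right)
    show "\<forall>j\<in>{..<length w} - {..<Suc k}. max 0 (min 1 (t - real j)) *\<^sub>R \<delta> j = 0"
      using assms by (auto simp: max_def min_def)
  qed (use assms in auto)
  also have "\<dots> = (\<Sum>j<k. max 0 (min 1 (t - real j)) *\<^sub>R \<delta> j) + (t - real k) *\<^sub>R \<delta> k"
    using assms by simp
  also have "(\<Sum>j<k. max 0 (min 1 (t - real j)) *\<^sub>R \<delta> j) = (\<Sum>j<k. \<delta> j)"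
    using assms by (intro sum.cong refl) (auto simp: max_def min_def)
  also have "\<dots> = lift_pt (path_vertex w k) - lift_pt (path_vertex w 0)"
    unfolding \<delta>_def by (rule sum_lessThan_telescope)
  also have "lift_pt (path_vertex w 0) = 0"
    by (simp add: lift_pt_def sqsum_def zero_prod_def)
  finally show ?thesis by (simp add: \<delta>_def)
qed

lemma path_fun_in_segment:
  assumes "k < length w" "real k \<le> t" "t \<le> real k + 1"
  shows "path_fun w t \<in> path_segment w k"
  unfolding path_segment_def closed_segment_def path_fun_eq[OF assms]
  using assms(2,3) by (intro CollectI exI[of _ "t - real k"]) (auto simp: algebra_simps)

lemma path_segment_cases:
  assumes "z \<in> path_segment w k" "k < length w"
  shows "real k \<le> height z" "height z \<le> real k + 1" "z = path_fun w (height z)"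
proof -
  obtain s where s: "0 \<le> s" "s \<le> 1"
    "z = (1 - s) *\<^sub>R lift_pt (path_vertex w k) + s *\<^sub>R lift_pt (path_vertex w (Suc k))"
    using assms(1) unfolding path_segment_def closed_segment_def by blast
  have h: "height z = real k + s"
    unfolding s(3) by (simp add: linear_add[OF linear_height] linear_scale[OF linear_height]
        linear_diff[OF linear_height] algebra_simps del: path_vertex.simps)
  then have ht: "height z - real k = s" by simp
  show "real k \<le> height z" "height z \<le> real k + 1" using h s by auto
  then show "z = path_fun w (height z)"
    unfolding path_fun_eq[OF assms(2) \<open>real k \<le> height z\<close> \<open>height z \<le> real k + 1\<close>]
      ht
    by (simp add: s(3) algebra_simps del: path_vertex.simps)
qed

lemma obtain_step:
  assumes "0 \<le> t" "t \<le> real n" "0 < n"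
  obtains k where "k < n" "real k \<le> t" "t \<le> real k + 1"
proof (cases "t = real n")
  case True
  then show ?thesis using assms that[of "n - 1"] by (auto simp: of_nat_diff)
next
  case False
  define k where "k = nat \<lfloor>t\<rfloor>"
  have "real k \<le> t" "t < real k + 1" using assms by (auto simp: k_def)
  moreover have "k < n" using calculation False assms by linarith
  ultimately show ?thesis using that[of k] by simp
qed

lemma path_fun_height:
  assumes "0 \<le> t" "t \<le> real (length w)" "w \<noteq> []"
  shows "height (path_fun w t) = t"
proof -
  obtain k where k: "k < length w" "real k \<le> t" "t \<le> real k + 1"
    using obtain_step[OF assms(1,2)] assms(3) by auto
  show ?thesis
    unfolding path_fun_eq[OF k]
    by (simp add: linear_add[OF linear_height] linear_scale[OF linear_height]
        linear_diff[OF linear_height] del: path_vertex.simps)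
qed

lemma path_fun_vertex:
  assumes "k \<le> length w" "w \<noteq> []"
  shows "path_fun w (real k) = lift_pt (path_vertex w k)"
proof (cases "k < length w")
  case True
  then show ?thesis using path_fun_eq[of k w "real k"] by simp
next
  case False
  then obtain j where "k = Suc j" "j < length w" using assms by (cases k) auto
  then show ?thesis using path_fun_eq[of j w "real k"] by (simp del: path_vertex.simps)
qed

lemma path_fun_in_polytope:
  assumes "lambda_permutation lam w" "0 \<le> t" "t \<le> real (length w)" "w \<noteq> []"
  shows "path_fun w t \<in> lifted_polytope lam"
proof -
  obtain k where k: "k < length w" "real k \<le> t" "t \<le> real k + 1"
    using obtain_step[OF assms(2,3)] assms(4) by auto
  have "lift_pt (path_vertex w j) \<in> lifted_polytope lam" if "j \<le> length w" for j
    using path_vertex_lattice[OF assms(1) that] by (rule lift_lattice_in_polytope)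
  then have "path_segment w k \<subseteq> lifted_polytope lam"
    unfolding path_segment_def
    using k by (intro closed_segment_subset convex_lifted_polytope) (auto simp del: path_vertex.simps)
  then show ?thesis using path_fun_in_segment[OF k] by blast
qed

lemma nth_lifted_path:
  "k \<le> length w \<Longrightarrow> lifted_path w ! k = lift_pt (path_vertex w k)"
  unfolding lifted_path_def by (simp add: nth_map del: upt_Suc path_vertex.simps)

lemma path_points_eq:
  assumes "w \<noteq> []"
  shows "path_points (lifted_path w) = path_fun w ` {0..real (length w)}"
proof -
  note nth = nth_lifted_path[of _ w]
  have len: "length (lifted_path w) = Suc (length w)" by (simp add: lifted_path_def)
  have "set (lifted_path w) = (\<lambda>k. lift_pt (path_vertex w k)) ` {..length w}"
    unfolding lifted_path_def set_map set_upt by (simp only: atLeast0_lessThan_Suc atMost_Suc lessThan_Suc_atMost atLeast0LessThan)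
  moreover have "(\<Union>k\<in>{k. Suc k < length (lifted_path w)}.
      closed_segment (lifted_path w ! k) (lifted_path w ! Suc k)) = (\<Union>k<length w. path_segment w k)"
    unfolding len by (auto simp: nth path_segment_def simp del: path_vertex.simps)
  ultimately have eq: "path_points (lifted_path w)
      = (\<lambda>k. lift_pt (path_vertex w k)) ` {..length w} \<union> (\<Union>k<length w. path_segment w k)"
    unfolding path_points_def by simp
  show ?thesis
    unfolding eq
  proof (intro equalityI subsetI)
    fix z assume "z \<in> (\<lambda>k. lift_pt (path_vertex w k)) ` {..length w} \<union> (\<Union>k<length w. path_segment w k)"
    then consider k where "k \<le> length w" "z = path_fun w (real k)" | k where "k < length w" "z \<in> path_segment w k"
      using path_fun_vertex[OF _ assms] by auto
    then show "z \<in> path_fun w ` {0..real (length w)}"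
    proof cases
      case 2
      then show ?thesis
        using path_segment_cases[OF 2(2,1)] by (intro image_eqI[of _ _ "height z"]) auto
    qed auto
  next
    fix z assume "z \<in> path_fun w ` {0..real (length w)}"
    then obtain t where "0 \<le> t" "t \<le> real (length w)" "z = path_fun w t" by auto
    moreover obtain k where "k < length w" "real k \<le> t" "t \<le> real k + 1"
      using obtain_step[of t "length w"] calculation assms by auto
    ultimately show "z \<in> (\<lambda>k. lift_pt (path_vertex w k)) ` {..length w} \<union> (\<Union>k<length w. path_segment w k)"
      using path_fun_in_segment[of k w t] by blast
  qed
qed

text \<open>At a fixed height \<open>lfun y\<close> and \<open>tilted y t\<close> differ by a
  constant, and the minimal segment meets that height in a single point. Coherence and the
  extremality of centroids both rest on this.\<close>

lemma path_fun_minimal: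
  assumes w: "lambda_permutation lam w" "realizes y w" "w \<noteq> []"
    and z: "z \<in> lifted_polytope lam"
  shows "lfun y (path_fun w (height z)) \<le> lfun y z"
    and "lfun y z \<le> lfun y (path_fun w (height z)) \<Longrightarrow> z = path_fun w (height z)"
proof -
  have hz: "0 \<le> height z" "height z \<le> real (length w)"
    using height_bounds[OF z] by (simp_all add: lambda_permutation_length[OF w(1)])
  obtain k where k: "k < length w" "real k \<le> height z" "height z \<le> real k + 1"
    using obtain_step[OF hz] w(3) by auto
  define t where "t = step_cost y w k"
  define m where "m = tilted y t (lift_pt (path_vertex w k))"
  have seg: "{z \<in> lifted_polytope lam. tilted y t z = m} = path_segment w k"
    unfolding t_def m_def by (rule tilted_polytope(2)[OF w(1,2) k(1)])
  have "tilted y t (path_fun w (height z)) = m"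
    using path_fun_in_segment[OF k] seg by blast
  then have diff: "lfun y z - lfun y (path_fun w (height z)) = tilted y t z - m"
    using path_fun_height[OF hz w(3)] by (simp add: tilted_def)
  have ge: "m \<le> tilted y t z"
    unfolding t_def m_def by (rule tilted_polytope(1)[OF w(1,2) k(1) z])
  show "lfun y (path_fun w (height z)) \<le> lfun y z" using diff ge by simp
  show "z = path_fun w (height z)" if "lfun y z \<le> lfun y (path_fun w (height z))"
  proof -
    have "tilted y t z = m" using that diff ge by simp
    then have "z \<in> path_segment w k" using seg z by blast
    then show ?thesis by (rule path_segment_cases) (rule k)
  qed
qed

subsection \<open>Coherence\<close>

lemma lower_boundary_preimage:
  "{x \<in> P. (\<phi> x, c x) \<in> lower_boundary ((\<lambda>y. (\<phi> y, c y)) ` P)}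
     = {x \<in> P. \<forall>y\<in>P. \<phi> y = \<phi> x \<longrightarrow> c x \<le> c y}"
  unfolding lower_boundary_def by (fastforce simp: image_iff)

text \<open>The path runs from height 0 to height \<open>n\<close>, the least and the greatest
  height in the polytope, so strict monotonicity forbids any extension.\<close>

lemma realizes_imp_maximal:
  fixes lam :: "'d::finite \<Rightarrow> nat"
  assumes w: "lambda_permutation lam w" "realizes y w" "w \<noteq> []"
  shows "maximal_monotone_edge_path height (lifted_polytope lam) (lifted_path w)"
proof -
  note nth = nth_lifted_path[of _ w]
  have len: "length (lifted_path w) = Suc (length w)" by (simp add: lifted_path_def)
  have edge: "path_segment w k edge_of lifted_polytope lam" if "k < length w" for k
    using path_segment_edge[OF w(1,2) that] .
  have extreme: "lift_pt (path_vertex w k) extreme_point_of lifted_polytope lam" if "k \<le> length w" for k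
  proof -
    have "\<exists>j<length w. k = j \<or> k = Suc j"
      using that w(3) by (intro exI[of _ "if k < length w then k else k - 1"]) auto
    then obtain j where j: "j < length w" "k = j \<or> k = Suc j" by blast
    then have "lift_pt (path_vertex w k) extreme_point_of path_segment w j"
      unfolding path_segment_def by (auto simp: extreme_point_of_segment simp del: path_vertex.simps)
    moreover have "path_segment w j face_of lifted_polytope lam"
      using edge[OF j(1)] by (simp add: edge_of_def)
    ultimately show ?thesis using extreme_point_of_face by blast
  qed
  have mono: "monotone_edge_path height (lifted_polytope lam) (lifted_path w)"
    unfolding monotone_edge_path_def
  proof (intro conjI allI impI ballI)
    show "lifted_path w \<noteq> []" using len by auto
    show "v extreme_point_of lifted_polytope lam" if "v \<in> set (lifted_path w)" for v
      using that extreme unfolding in_set_conv_nth len by (auto simp: nth less_Suc_eq_le)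
    fix k assume "Suc k < length (lifted_path w)"
    then have k: "k < length w" using len by simp
    show "closed_segment (lifted_path w ! k) (lifted_path w ! Suc k) edge_of lifted_polytope lam"
      using edge[OF k] k by (simp add: nth path_segment_def del: path_vertex.simps)
    show "height (lifted_path w ! k) < height (lifted_path w ! Suc k)"
      using k by (simp add: nth del: path_vertex.simps)
  qed
  have "us = [] \<and> vs = []"
    if ext: "monotone_edge_path height (lifted_polytope lam) (us @ lifted_path w @ vs)" for us vs
  proof -
    define p where "p = us @ lifted_path w @ vs"
    have inP: "v \<in> lifted_polytope lam" if "v \<in> set p" for v
      using ext that unfolding monotone_edge_path_def p_def extreme_point_of_def by blast
    have less: "height (p ! k) < height (p ! Suc k)" if "Suc k < length p" for k
      using ext that unfolding monotone_edge_path_def p_def by blast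
    have nthp: "p ! (length us + k) = lift_pt (path_vertex w k)" if "k \<le> length w" for k
      using that nth[OF that] len by (simp add: p_def nth_append)
    have "us = []"
    proof (rule ccontr)
      assume "us \<noteq> []"
      then obtain k where k: "length us = Suc k" by (cases us) auto
      then have "height (p ! k) < height (p ! Suc k)"
        by (intro less) (simp add: p_def len)
      also have "height (p ! Suc k) = 0"
        using nthp[of 0] k height_lift_path_vertex[of w 0] by (simp del: path_vertex.simps height_lift_path_vertex)
      finally have "height (p ! k) < 0" .
      moreover have "p ! k \<in> set p" using k by (intro nth_mem) (simp add: p_def)
      ultimately show False using height_bounds(1)[OF inP] by fastforce
    qed
    moreover have "vs = []"
    proof (rule ccontr)
      assume "vs \<noteq> []"
      then have l: "length us + length w + 1 < length p" by (simp add: p_def len)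
      then have "height (p ! (length us + length w)) < height (p ! (length us + length w + 1))"
        using less[of "length us + length w"] by simp
      then have "real (length w) < height (p ! (length us + length w + 1))"
        by (simp add: nthp)
      moreover have "p ! (length us + length w + 1) \<in> set p" using l by (intro nth_mem)
      ultimately show False
        using height_bounds(2)[OF inP] lambda_permutation_length[OF w(1)] by fastforce
    qed
    ultimately show ?thesis ..
  qed
  with mono show ?thesis unfolding maximal_monotone_edge_path_def by blast
qed

lemma realizes_imp_coherent:
  fixes lam :: "'d::finite \<Rightarrow> nat"
  assumes w: "lambda_permutation lam w" "realizes y w" "w \<noteq> []"
  shows "coherent height (lifted_polytope lam) (lifted_path w)"
proof -
  have "{x \<in> lifted_polytope lam. \<forall>z\<in>lifted_polytope lam. height z = height x \<longrightarrow> lfun y x \<le> lfun y z}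
      = path_fun w ` {0..real (length w)}" (is "?L = ?R")
  proof (intro equalityI subsetI)
    fix x assume x: "x \<in> ?L"
    have hx: "0 \<le> height x" "height x \<le> real (length w)"
      using x height_bounds[of x lam] by (auto simp: lambda_permutation_length[OF w(1)])
    have "lfun y x \<le> lfun y (path_fun w (height x))"
      using x path_fun_in_polytope[OF w(1) hx w(3)] path_fun_height[OF hx w(3)] by simp
    then have "x = path_fun w (height x)" using path_fun_minimal(2)[OF w] x by blast
    then show "x \<in> ?R" using hx by auto
  next
    fix x assume "x \<in> ?R"
    then obtain t where t: "0 \<le> t" "t \<le> real (length w)" "x = path_fun w t" by auto
    then have "height x = t" using path_fun_height w(3) by blast
    then show "x \<in> ?L"
      using path_fun_in_polytope[OF w(1) t(1,2) w(3)] path_fun_minimal(1)[OF w] t(3) by auto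
  qed
  then show ?thesis
    unfolding coherent_def lower_boundary_preimage path_points_eq[OF w(3)]
    using realizes_imp_maximal[OF w] linear_lfun by blast
qed

lemma sqsum_add_axis: "sqsum (v + axis i t) = sqsum v + 2 * t * v $ i + t\<^sup>2"
proof -
  have "sqsum (v + axis i t) - sqsum v = (\<Sum>j\<in>UNIV. if j = i then 2 * t * v $ i + t\<^sup>2 else 0)"
    unfolding sqsum_def sum_subtractf[symmetric]
    by (intro sum.cong) (auto simp: axis_def power2_eq_square algebra_simps)
  then show ?thesis by simp
qed

lemma add_axis_lattice:
  assumes "v \<in> lambda_box lam \<inter> lattice_points" "t \<in> \<int>" "0 \<le> v $ i + t" "v $ i + t \<le> real (lam i)"
  shows "v + axis i t \<in> lambda_box lam \<inter> lattice_points"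
  using assms unfolding lambda_box_def lattice_points_def axis_def by auto

text \<open>Coherence makes the path the whole set of heightwise minimizers, and the path meets each
  height only once; hence the minimum at a path vertex is strict.\<close>

lemma coherent_minimum:
  fixes lam :: "'d::finite \<Rightarrow> nat" and c :: "(real ^ 'd) \<times> real \<Rightarrow> real"
  assumes w: "lambda_permutation lam w" "w \<noteq> []"
    and c: "{x \<in> lifted_polytope lam. \<forall>z\<in>lifted_polytope lam. height z = height x \<longrightarrow> c x \<le> c z}
      = path_points (lifted_path w)"
    and k: "k \<le> length w" and z: "z \<in> lifted_polytope lam" "height z = real k"
    and ne: "z \<noteq> lift_pt (path_vertex w k)"
  shows "c (lift_pt (path_vertex w k)) < c z"
proof (rule ccontr)
  assume "\<not> ?thesis"
  then have le: "c z \<le> c (lift_pt (path_vertex w k))" by simp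
  have "path_fun w (real k) \<in> path_points (lifted_path w)"
    using k unfolding path_points_eq[OF w(2)] by auto
  then have "lift_pt (path_vertex w k) \<in> path_points (lifted_path w)"
    using path_fun_vertex[OF k w(2)] by simp
  then have min: "c (lift_pt (path_vertex w k)) \<le> c x" if "x \<in> lifted_polytope lam" "height x = real k" for x
    using that unfolding c[symmetric] by auto
  then have "z \<in> path_points (lifted_path w)"
    unfolding c[symmetric] using z le by (auto intro: order_trans)
  then obtain t where t: "0 \<le> t" "t \<le> real (length w)" "z = path_fun w t"
    unfolding path_points_eq[OF w(2)] by auto
  then have "t = real k" using path_fun_height[OF t(1,2) w(2)] z(2) by simp
  then have "z = lift_pt (path_vertex w k)" using t(3) path_fun_vertex[OF k w(2)] by simp
  with ne show False ..
qed

text \<open>Once its last coefficient \<open>b\<close> is known to be positive, a coherent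
  functional is \<open>b\<close> times some \<open>lfun y\<close>, and comparing path vertices with
  neighbouring lattice points shows that this \<open>y\<close> realizes \<open>w\<close>.\<close>

lemma coherent_imp_not_nesting:
  fixes lam :: "'d::finite \<Rightarrow> nat"
  assumes w: "lambda_permutation lam w" "w \<noteq> []"
    and coh: "coherent height (lifted_polytope lam) (lifted_path w)"
  shows "\<not> nesting w"
proof
  assume nest: "nesting w"
  obtain c :: "(real ^ 'd) \<times> real \<Rightarrow> real" where lin: "linear c" and
    c: "{x \<in> lifted_polytope lam. \<forall>z\<in>lifted_polytope lam. height z = height x \<longrightarrow> c x \<le> c z}
      = path_points (lifted_path w)"
    using coh unfolding coherent_def lower_boundary_preimage by blast
  note minimum = coherent_minimum[OF w c]
  define a where "a i = c (axis i 1, 0)" for i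
  define b where "b = c (0, 1)"
  have c_step: "c (v + axis i 1, s + e) = c (v, s) + a i + e * b" for v i s e
  proof -
    have "(v + axis i 1, s + e) = (v, s) + (axis i 1, 0) + e *\<^sub>R (0, 1)" by simp
    then show ?thesis
      unfolding a_def b_def by (simp only: linear_add[OF lin] linear_scale[OF lin] real_scaleR_def)
  qed
  have pv: "path_vertex w k \<in> lambda_box lam \<inter> lattice_points" if "k \<le> length w" for k
    using path_vertex_lattice[OF w(1) that] .
  have cnt: "path_vertex w k $ i = real (count (mset (take k w)) i)" if "k \<le> length w" for k i
    using path_vertex_nth[OF that] .
  have lam: "lam i = count (mset w) i" for i using w(1) by (simp add: lambda_permutation_def)
  text \<open>Halfway between \<open>v - e\<^sub>i\<close> and \<open>v + e\<^sub>i\<close> the polytope has a point lying one unit above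
    the lift of \<open>v\<close>.\<close>
  have b: "0 < b"
  proof -
    obtain i l where il: "i < l" "l < length w" "w ! i = w ! l"
      using nest unfolding nesting_def by (metis less_trans)
    \<comment> \<open>Just after the first of two equal letters, coordinate \<open>x\<close> lies
      strictly between 0 and \<open>lam x\<close>, so both lattice neighbours in this direction are
      in the box.\<close>
    define k where "k = Suc i"
    define v where "v = path_vertex w k"
    define x where "x = w ! i"
    have k: "k \<le> length w" "k \<le> l" using il by (auto simp: k_def)
    have "0 < count (mset (take k w)) x"
      using il unfolding k_def x_def by (subst count_take_Suc) auto
    then have low: "1 \<le> v $ x" using cnt[OF k(1)] by (simp add: v_def)
    have "count (mset (take k w)) x \<le> count (mset (take l w)) x" using k by (intro count_take_mono)
    also have "\<dots> < count (mset (take (Suc l) w)) x"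
      using il by (simp add: count_take_Suc x_def)
    also have "\<dots> \<le> lam x" unfolding lam by (rule count_take_le)
    finally have high: "v $ x + 1 \<le> real (lam x)" using cnt[OF k(1)] by (simp add: v_def)
    have P: "lift_pt (v + axis x t) \<in> lifted_polytope lam" if "t \<in> {1, -1}" for t
      using that low high pv[OF k(1)]
      by (intro lift_lattice_in_polytope add_axis_lattice) (auto simp: v_def)
    have "(1/2) *\<^sub>R lift_pt (v + axis x 1) + (1/2) *\<^sub>R lift_pt (v + axis x (-1)) \<in> lifted_polytope lam"
      using P convex_lifted_polytope[of lam] by (intro convexD) auto
    also have "(1/2) *\<^sub>R lift_pt (v + axis x 1) + (1/2) *\<^sub>R lift_pt (v + axis x (-1)) = (v, sqsum v + 1)"
    proof -
      have "(1/2) *\<^sub>R (v + axis x 1) + (1/2) *\<^sub>R (v + axis x (-1)) = v"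
        by (auto simp: vec_eq_iff axis_def field_simps)
      moreover have "(1/2) * sqsum (v + axis x 1) + (1/2) * sqsum (v + axis x (-1)) = sqsum v + 1"
        by (simp add: sqsum_add_axis field_simps)
      ultimately show ?thesis unfolding lift_pt_def by simp
    qed
    finally have "c (lift_pt v) < c (v, sqsum v + 1)"
      using minimum[OF k(1), of "(v, sqsum v + 1)"] height_lift_path_vertex[of w k]
      by (simp add: v_def lift_pt_def height_def)
    moreover have "c (v, sqsum v + 1) = c (lift_pt v) + b"
    proof -
      have "(v, sqsum v + 1) = lift_pt v + (0, 1)" by (simp add: lift_pt_def)
      then show ?thesis by (simp only: linear_add[OF lin] b_def)
    qed
    ultimately show "0 < b" by simp
  qed
  \<comment> \<open>Solves \<open>a i = b * (2 * y i - 1)\<close>.\<close>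
  define y where "y i = (a i / b + 1) / 2" for i
  have step: "c (lift_pt (v + axis i 1)) = c (lift_pt v) + 2 * b * (y i + v $ i)" for v i
  proof -
    have "c (lift_pt (v + axis i 1)) = c (v + axis i 1, sqsum v + (2 * v $ i + 1))"
      by (simp add: lift_pt_def sqsum_add_axis add.assoc)
    also have "\<dots> = c (lift_pt v) + a i + (2 * v $ i + 1) * b"
      unfolding c_step lift_pt_def ..
    finally show ?thesis using b by (simp add: y_def field_simps)
  qed
  have "realizes y w"
  proof (rule realizesI_adjacent)
    fix k assume k: "Suc k < length w"
    show "step_cost y w k < step_cost y w (Suc k)"
    proof (cases "w ! k = w ! Suc k")
      case True
      then show ?thesis using k by (simp add: step_cost_def count_take_Suc)
    next
      case False
      \<comment> \<open>The competitor at height \<open>k + 1\<close> swaps the order of the two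
        letters: from \<open>v\<close> it takes the next letter \<open>x\<close> first. This stays
        in the box because \<open>x\<close> does occur at position \<open>k + 1\<close>.\<close>
      define v where "v = path_vertex w k"
      define x where "x = w ! Suc k"
      have vx: "v $ x = real (count (mset (take (Suc k) w)) x)"
        using k False cnt[of k x] by (simp add: v_def x_def count_take_Suc)
      have "count (mset (take (Suc k) w)) x < count (mset (take (Suc (Suc k)) w)) x"
        using k unfolding x_def by (subst (2) count_take_Suc) auto
      also have "\<dots> \<le> lam x" unfolding lam by (rule count_take_le)
      finally have "v $ x + 1 \<le> real (lam x)" by (simp add: vx)
      then have "v + axis x 1 \<in> lambda_box lam \<inter> lattice_points"
        using pv[of k] k by (intro add_axis_lattice) (auto simp: v_def cnt)
      then have "lift_pt (v + axis x 1) \<in> lifted_polytope lam"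
        by (rule lift_lattice_in_polytope)
      moreover have "height (lift_pt (v + axis x 1)) = real (Suc k)"
        using height_lift_path_vertex[of w k]
        by (simp add: lift_pt_def height_def sum.distrib axis_def v_def)
      moreover have "lift_pt (v + axis x 1) \<noteq> lift_pt (path_vertex w (Suc k))"
        using False by (auto simp: lift_pt_def v_def x_def axis_eq_axis)
      ultimately have "c (lift_pt (path_vertex w (Suc k))) < c (lift_pt (v + axis x 1))"
        using minimum[of "Suc k"] k by simp
      then have "2 * b * (y (w ! k) + v $ (w ! k)) < 2 * b * (y x + v $ x)"
        using step[of v "w ! k"] step[of v x] by (simp add: v_def)
      then have "y (w ! k) + v $ (w ! k) < y x + v $ x" using b by simp
      moreover have "v $ (w ! k) = real (count (mset (take k w)) (w ! k))"
        using cnt[of k "w ! k"] k by (simp add: v_def)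
      ultimately show ?thesis unfolding step_cost_def using vx by (simp add: x_def)
    qed
  qed
  then show False using nest realizes_imp_not_nesting by blast
qed

subsection \<open>Lower vertices of the monotone path polytope\<close>

definition centroid :: "'d::finite list \<Rightarrow> (real ^ 'd) \<times> real" where
  "centroid w = (1 / real (length w)) *\<^sub>R integral {0..real (length w)} (path_fun w)"

lemma linear_integral_section:
  fixes f :: "'a::euclidean_space \<Rightarrow> real"
  assumes "linear f" "continuous_on {0..b::real} \<gamma>"
  shows "f (c *\<^sub>R integral {0..b} \<gamma>) = c * integral {0..b} (\<lambda>t. f (\<gamma> t))"
proof -
  have "integral {0..b} (f \<circ> \<gamma>) = f (integral {0..b} \<gamma>)"
    using assms by (intro integral_linear integrable_continuous_interval) (simp_all add: linear_conv_bounded_linear)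
  then show ?thesis using assms(1) by (simp add: linear_scale o_def)
qed

text \<open>Pointwise minimality of the path integrates. In the case of equality a continuous
  nonnegative difference has integral 0 and therefore vanishes everywhere.\<close>

lemma centroid_minimal:
  fixes lam :: "'d::finite \<Rightarrow> nat"
  assumes w: "lambda_permutation lam w" "realizes y w" "w \<noteq> []"
    and \<gamma>: "continuous_on {0..real (length w)} \<gamma>"
      "\<And>t. t \<in> {0..real (length w)} \<Longrightarrow> \<gamma> t \<in> lifted_polytope lam \<and> height (\<gamma> t) = t"
  defines "v \<equiv> (1 / real (length w)) *\<^sub>R integral {0..real (length w)} \<gamma>"
  shows "lfun y (centroid w) \<le> lfun y v"
    and "lfun y v \<le> lfun y (centroid w) \<Longrightarrow> \<forall>t\<in>{0..real (length w)}. \<gamma> t = path_fun w t"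
proof -
  define n where "n = real (length w)"
  have n: "0 < n" using w(3) by (simp add: n_def)
  define \<delta> where "\<delta> t = lfun y (\<gamma> t) - lfun y (path_fun w t)" for t
  have lfun_cont: "continuous_on S (\<lambda>t. lfun y (g t))" if "continuous_on S g" for S :: "real set" and g
    using bounded_linear.continuous_on[OF _ that] linear_lfun[of y]
    by (simp add: linear_conv_bounded_linear)
  have cont: "continuous_on {0..n} \<delta>"
    unfolding \<delta>_def using \<gamma>(1) continuous_on_path_fun[of "{0..n}" w] lfun_cont n_def
    by (intro continuous_on_diff) auto
  have nonneg: "0 \<le> \<delta> t" if "t \<in> {0..n}" for t
    using path_fun_minimal(1)[OF w, of "\<gamma> t"] \<gamma>(2)[of t] that by (simp add: \<delta>_def n_def)
  have "lfun y v - lfun y (centroid w) = (1 / n) * integral {0..n} \<delta>"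
  proof -
    have "integral {0..n} \<delta> = integral {0..n} (\<lambda>t. lfun y (\<gamma> t)) - integral {0..n} (\<lambda>t. lfun y (path_fun w t))"
      unfolding \<delta>_def using \<gamma>(1) continuous_on_path_fun[of "{0..n}" w] lfun_cont n_def
      by (intro integral_diff integrable_continuous_interval) auto
    moreover have "lfun y v = (1 / n) * integral {0..n} (\<lambda>t. lfun y (\<gamma> t))"
      unfolding v_def n_def using \<gamma>(1) by (rule linear_integral_section[OF linear_lfun])
    moreover have "lfun y (centroid w) = (1 / n) * integral {0..n} (\<lambda>t. lfun y (path_fun w t))"
      unfolding centroid_def n_def by (rule linear_integral_section[OF linear_lfun continuous_on_path_fun])
    ultimately show ?thesis by (simp add: right_diff_distrib)
  qed
  moreover have int: "\<delta> integrable_on {0..n}" using cont by (rule integrable_continuous_interval)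
  then have pos: "0 \<le> integral {0..n} \<delta>" using nonneg by (rule integral_nonneg)
  ultimately show "lfun y (centroid w) \<le> lfun y v"
    using n by (metis diff_ge_0_iff_ge divide_nonneg_pos mult_1 times_divide_eq_left)
  show "\<forall>t\<in>{0..real (length w)}. \<gamma> t = path_fun w t" if "lfun y v \<le> lfun y (centroid w)"
  proof
    fix t assume t: "t \<in> {0..real (length w)}"
    have "(1 / n) * integral {0..n} \<delta> \<le> 0"
      using that \<open>lfun y v - lfun y (centroid w) = _\<close> by linarith
    then have "integral {0..n} \<delta> = 0" using pos n by (simp add: mult_le_0_iff field_simps)
    then have "(\<delta> has_integral 0) (cbox 0 n)"
      using int by (metis cbox_interval integrable_integral)
    then have "\<delta> t = 0"
      using cont nonneg n t
      by (intro has_integral_0_cbox_imp_0[of 0 n \<delta>]) (auto simp: n_def box_real)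
    then show "\<gamma> t = path_fun w t"
      using path_fun_minimal(2)[OF w, of "\<gamma> t"] \<gamma>(2)[OF t] by (simp add: \<delta>_def)
  qed
qed

lemma monotone_path_polytopeE:
  assumes "v \<in> monotone_path_polytope n lam"
  obtains \<gamma> where "v = (1 / real n) *\<^sub>R integral {0..real n} \<gamma>" "continuous_on {0..real n} \<gamma>"
    "\<And>t. t \<in> {0..real n} \<Longrightarrow> \<gamma> t \<in> lifted_polytope lam \<and> height (\<gamma> t) = t"
  using assms unfolding monotone_path_polytope_def by blast

lemma centroid_in_polytope:
  assumes "lambda_permutation lam w" "w \<noteq> []" "length w = n"
  shows "centroid w \<in> monotone_path_polytope n lam"
  unfolding monotone_path_polytope_def centroid_def
  using assms path_fun_in_polytope[OF assms(1) _ _ assms(2)] path_fun_height[OF _ _ assms(2)]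
    continuous_on_path_fun by (intro CollectI exI[of _ "path_fun w"]) auto

lemma convex_monotone_path_polytope: "convex (monotone_path_polytope n lam)"
proof (rule convexI)
  fix x y and u v :: real
  assume H: "x \<in> monotone_path_polytope n lam" "y \<in> monotone_path_polytope n lam"
    "0 \<le> u" "0 \<le> v" "u + v = 1"
  obtain \<gamma> where \<gamma>: "x = (1 / real n) *\<^sub>R integral {0..real n} \<gamma>" "continuous_on {0..real n} \<gamma>"
    "\<And>t. t \<in> {0..real n} \<Longrightarrow> \<gamma> t \<in> lifted_polytope lam \<and> height (\<gamma> t) = t"
    using H(1) by (blast elim: monotone_path_polytopeE)
  obtain \<eta> where \<eta>: "y = (1 / real n) *\<^sub>R integral {0..real n} \<eta>" "continuous_on {0..real n} \<eta>"
    "\<And>t. t \<in> {0..real n} \<Longrightarrow> \<eta> t \<in> lifted_polytope lam \<and> height (\<eta> t) = t"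
    using H(2) by (blast elim: monotone_path_polytopeE)
  define \<zeta> where "\<zeta> t = u *\<^sub>R \<gamma> t + v *\<^sub>R \<eta> t" for t
  have "integral {0..real n} \<zeta> = u *\<^sub>R integral {0..real n} \<gamma> + v *\<^sub>R integral {0..real n} \<eta>"
    unfolding \<zeta>_def using \<gamma>(2) \<eta>(2)
    by (subst integral_add) (auto intro!: integrable_continuous_interval continuous_intros)
  then have "u *\<^sub>R x + v *\<^sub>R y = (1 / real n) *\<^sub>R integral {0..real n} \<zeta>"
    unfolding \<gamma>(1) \<eta>(1) by (simp add: scaleR_add_right mult.commute)
  moreover have "continuous_on {0..real n} \<zeta>"
    unfolding \<zeta>_def using \<gamma>(2) \<eta>(2) by (intro continuous_intros)
  moreover have "\<zeta> t \<in> lifted_polytope lam \<and> height (\<zeta> t) = t" if "t \<in> {0..real n}" for t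
  proof
    show "\<zeta> t \<in> lifted_polytope lam"
      unfolding \<zeta>_def using H \<gamma>(3)[OF that] \<eta>(3)[OF that] by (intro convexD[OF convex_lifted_polytope]) auto
    have "height (\<zeta> t) = u * t + v * t"
      unfolding \<zeta>_def using \<gamma>(3)[OF that] \<eta>(3)[OF that]
      by (simp add: linear_add[OF linear_height] linear_scale[OF linear_height])
    then show "height (\<zeta> t) = t" using H(5) by (simp add: distrib_right[symmetric])
  qed
  ultimately show "u *\<^sub>R x + v *\<^sub>R y \<in> monotone_path_polytope n lam"
    unfolding monotone_path_polytope_def by blast
qed

lemma path_vertex_inject:
  assumes eq: "\<And>j. j \<le> length w \<Longrightarrow> lift_pt (path_vertex w' j) = lift_pt (path_vertex w j)"
    and "length w' = length w"
  shows "w' = w"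
proof (rule nth_equalityI)
  fix k assume "k < length w'"
  then have k: "k < length w" using assms(2) by simp
  have "path_vertex w' k = path_vertex w k" "path_vertex w' (Suc k) = path_vertex w (Suc k)"
    using eq[of k] eq[of "Suc k"] k by (simp_all add: lift_pt_def del: path_vertex.simps)
  then have "axis (w' ! k) (1::real) = axis (w ! k) 1" by simp
  then show "w' ! k = w ! k" by (simp add: axis_eq_axis)
qed (rule assms)

lemma path_fun_inject:
  assumes "\<forall>t\<in>{0..real (length w)}. path_fun w' t = path_fun w t" "length w' = length w" "w \<noteq> []"
  shows "w' = w"
proof (rule path_vertex_inject)
  show "lift_pt (path_vertex w' j) = lift_pt (path_vertex w j)" if "j \<le> length w" for j
    using assms that path_fun_vertex[of j w] path_fun_vertex[of j w'] by force
qed (rule assms)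

lemma lifted_path_inject:
  assumes "lifted_path w' = lifted_path w" "length w' = length w"
  shows "w' = w"
proof (rule path_vertex_inject)
  show "lift_pt (path_vertex w' j) = lift_pt (path_vertex w j)" if "j \<le> length w" for j
    using assms that nth_lifted_path[of j w] nth_lifted_path[of j w'] by simp
qed (rule assms)

text \<open>The centroid is the unique minimizer of \<open>lfun y\<close>, hence extreme; the
  functional \<open>- lfun y\<close> has last coefficient -1.\<close>

lemma centroid_lower_vertex:
  fixes lam :: "'d::finite \<Rightarrow> nat"
  assumes w: "lambda_permutation lam w" "realizes y w" "w \<noteq> []" "length w = n"
  shows "lower_vertex (monotone_path_polytope n lam) (centroid w)"
proof -
  let ?Q = "monotone_path_polytope n lam"
  have min: "lfun y (centroid w) \<le> lfun y v" if "v \<in> ?Q" for v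
    using that centroid_minimal(1)[OF w(1-3)] w(4) by (elim monotone_path_polytopeE) auto
  have uniq: "v = centroid w" if v: "v \<in> ?Q" "lfun y v \<le> lfun y (centroid w)" for v
  proof -
    obtain \<gamma> where \<gamma>: "v = (1 / real n) *\<^sub>R integral {0..real n} \<gamma>" "continuous_on {0..real n} \<gamma>"
      "\<And>t. t \<in> {0..real n} \<Longrightarrow> \<gamma> t \<in> lifted_polytope lam \<and> height (\<gamma> t) = t"
      using v(1) by (blast elim: monotone_path_polytopeE)
    then have "\<forall>t\<in>{0..real n}. \<gamma> t = path_fun w t"
      using centroid_minimal(2)[OF w(1-3), of \<gamma>] v(2) unfolding w(4) by blast
    then show ?thesis unfolding \<gamma>(1) centroid_def w(4) by (metis integral_cong)
  qed
  have "centroid w extreme_point_of ?Q"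
    unfolding extreme_point_of_def
  proof (intro conjI ballI notI)
    show "centroid w \<in> ?Q" using centroid_in_polytope w by blast
    fix a b assume ab: "a \<in> ?Q" "b \<in> ?Q" "centroid w \<in> open_segment a b"
    then obtain u where u: "a \<noteq> b" "0 < u" "u < 1" "centroid w = (1 - u) *\<^sub>R a + u *\<^sub>R b"
      unfolding in_segment by blast
    have "lfun y (centroid w) = (1 - u) * lfun y a + u * lfun y b"
      unfolding u(4) by (simp only: linear_add[OF linear_lfun] linear_scale[OF linear_lfun] real_scaleR_def)
    then have eq: "(1 - u) * (lfun y a - lfun y (centroid w)) + u * (lfun y b - lfun y (centroid w)) = 0"
      by (simp add: algebra_simps)
    moreover have "0 \<le> (1 - u) * (lfun y a - lfun y (centroid w))" "0 \<le> u * (lfun y b - lfun y (centroid w))"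
      using u min ab by simp_all
    ultimately have "(1 - u) * (lfun y a - lfun y (centroid w)) = 0" "u * (lfun y b - lfun y (centroid w)) = 0"
      by linarith+
    then have "a = centroid w" "b = centroid w" using u uniq ab by auto
    then show False using u(1) by simp
  qed
  moreover have "linear (\<lambda>x. - lfun y x)" by (rule linear_compose_neg[OF linear_lfun])
  moreover have "- lfun y (0, 1) < 0" by (simp add: lfun_def)
  ultimately show ?thesis
    unfolding lower_vertex_def using min
    by (intro conjI exI[of _ "\<lambda>x. - lfun y x"]) auto
qed

text \<open>If the centroids agree, the section of \<open>w'\<close> attains the minimum belonging
  to \<open>w\<close>, and the equality case identifies the two sections.\<close>

lemma inj_on_centroid:
  fixes lam :: "'d::finite \<Rightarrow> nat"
  assumes "\<And>w. w \<in> words lam \<Longrightarrow> length w = n \<and> w \<noteq> []"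
  shows "inj_on centroid (words lam)"
proof (rule inj_onI)
  fix w w' assume ww: "w \<in> words lam" "w' \<in> words lam" and eq: "centroid w = centroid w'"
  obtain y :: "real ^ 'd" where y: "realizes (($) y) w" and perm: "lambda_permutation lam w" "lambda_permutation lam w'"
    using ww words_iff_realizes by blast
  have n: "length w = n" "w \<noteq> []" "length w' = n" "w' \<noteq> []" using assms ww by auto
  have "\<forall>t\<in>{0..real (length w)}. path_fun w' t = path_fun w t"
  proof (rule centroid_minimal(2)[OF perm(1) y n(2)])
    show "continuous_on {0..real (length w)} (path_fun w')" by (rule continuous_on_path_fun)
    show "path_fun w' t \<in> lifted_polytope lam \<and> height (path_fun w' t) = t" if "t \<in> {0..real (length w)}" for t
      using that path_fun_in_polytope[OF perm(2) _ _ n(4)] path_fun_height[OF _ _ n(4)] n by simp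
    show "lfun (($) y) ((1 / real (length w)) *\<^sub>R integral {0..real (length w)} (path_fun w'))
        \<le> lfun (($) y) (centroid w)"
      unfolding eq unfolding centroid_def n by simp
  qed
  then show "w = w'" using path_fun_inject[of w w'] n by simp
qed

section \<open>Every lower vertex is a centroid\<close>

lemma negligible_arrangement:
  fixes lam :: "'d::{finite,linorder} \<Rightarrow> nat"
  shows "negligible (\<Union>(arrangement lam))"
proof (rule negligible_Union)
  let ?h = "\<lambda>(i::'d, j, m). {x :: (real, 'd) vec. x $ i - x $ j = real_of_int m}"
  define S where "S = (\<Union>i. \<Union>j. {i} \<times> {j} \<times> {- int (lam i) + 1..int (lam j) - 1})"
  have "arrangement lam \<subseteq> ?h ` S"
    unfolding arrangement_def S_def by force
  then show "finite (arrangement lam)" by (rule finite_subset) (simp add: S_def)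
  show "negligible H" if H_in: "H \<in> arrangement lam" for H
  proof -
    obtain i j m where "i < j" and H: "H = {x. x $ i - x $ j = real_of_int m}"
      using H_in unfolding arrangement_def by blast
    then have "axis i 1 - axis j 1 \<noteq> (0 :: (real, 'd) vec)" by (auto simp: axis_eq_axis)
    then have "negligible {x :: (real, 'd) vec. (axis i 1 - axis j 1) \<bullet> x = real_of_int m}"
      by (intro negligible_hyperplane) simp
    then show ?thesis by (simp add: H inner_diff_left inner_axis')
  qed
qed

text \<open>The coefficients \<open>y\<close> below are those of the given functional, tilted slightly by a functional
  separating \<open>v\<close> from the centroids; strict separation survives a perturbation that makes \<open>y\<close> generic.\<close>

lemma lower_vertex_centroid:
  fixes lam :: "'d::{finite,linorder} \<Rightarrow> nat"
  assumes fin: "finite (words lam)" and pos: "\<And>i. 0 < lam i"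
    and len: "\<And>w. w \<in> words lam \<Longrightarrow> length w = n \<and> w \<noteq> []"
    and v: "lower_vertex (monotone_path_polytope n lam) v"
  shows "v \<in> centroid ` words lam"
proof -
  let ?Q = "monotone_path_polytope n lam"
  have vQ: "v extreme_point_of ?Q" using v by (simp add: lower_vertex_def)
  obtain c :: "((real, 'd) vec) \<times> real \<Rightarrow> real" where c: "linear c" "c (0, 1) < 0" "\<And>x. x \<in> ?Q \<Longrightarrow> c x \<le> c v"
    using v unfolding lower_vertex_def by blast
  define K where "K = convex hull (centroid ` words lam)"
  have cent: "centroid w \<in> ?Q" if "w \<in> words lam" for w
    using that len[OF that] centroid_in_polytope[of lam w n] by (auto simp: words_def)
  have KQ: "K \<subseteq> ?Q"
    unfolding K_def using cent convex_monotone_path_polytope by (intro hull_minimal) auto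
  have "v \<in> K"
  proof (rule ccontr)
    assume "v \<notin> K"
    moreover have "convex K" "closed K"
      using fin by (auto simp: K_def intro!: compact_imp_closed finite_imp_compact_convex_hull)
    ultimately obtain g \<beta> where g: "g \<bullet> v < \<beta>" "\<And>x. x \<in> K \<Longrightarrow> \<beta> < g \<bullet> x"
      using separating_hyperplane_closed_point by metis
    \<comment> \<open>Small enough that adding \<open>\<epsilon>\<close> times \<open>g\<close> to
      \<open>- c\<close> keeps the last coefficient positive; the \<open>+ 1\<close> avoids division
      by zero.\<close>
    define \<epsilon> where "\<epsilon> = - c (0, 1) / (\<bar>snd g\<bar> + 1)"
    have \<epsilon>: "0 < \<epsilon>" using c(2) by (simp add: \<epsilon>_def divide_neg_pos)
    define F where "F z = \<epsilon> * (g \<bullet> z) - c z" for z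
    have linF: "linear F"
      unfolding F_def
      by (rule linearI) (simp_all add: linear_add[OF c(1)] linear_scale[OF c(1)] inner_add_right algebra_simps)
    define B where "B = F (0, 1)"
    have "\<epsilon> * \<bar>snd g\<bar> < - c (0, 1)"
    proof -
      have "\<epsilon> * (\<bar>snd g\<bar> + 1) = - c (0, 1)" by (simp add: \<epsilon>_def)
      then show ?thesis using \<epsilon> by (simp add: distrib_left)
    qed
    moreover have "- (\<epsilon> * \<bar>snd g\<bar>) \<le> \<epsilon> * snd g" using \<epsilon> by (simp add: abs_if)
    ultimately have B: "0 < B" by (simp add: B_def F_def inner_prod_def)
    define y :: "(real, 'd) vec" where "y = (\<chi> i. (F (axis i 1, 0) / B + 1) / 2)"
    have y_eq: "B * (2 * y $ i - 1) = F (axis i 1, 0)" for i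
      using B by (simp add: y_def field_simps)
    have F_eq: "F z = B * lfun (($) y) z" for z
    proof -
      have "z = (\<Sum>i\<in>UNIV. (fst z $ i) *\<^sub>R (axis i 1, 0)) + snd z *\<^sub>R (0, 1)"
        by (simp add: prod_eq_iff fst_sum snd_sum basis_expansion[of "fst z", unfolded scalar_mult_eq_scaleR])
      then have "F z = F ((\<Sum>i\<in>UNIV. (fst z $ i) *\<^sub>R (axis i 1, 0)) + snd z *\<^sub>R (0, 1))" by simp
      also have "\<dots> = (\<Sum>i\<in>UNIV. fst z $ i * F (axis i 1, 0)) + snd z * B"
        by (simp only: linear_add[OF linF] linear_sum[OF linF] linear_scale[OF linF] real_scaleR_def B_def)
      also have "\<dots> = B * lfun (($) y) z"
        unfolding lfun_def distrib_left sum_distrib_left by (simp add: y_eq[symmetric] mult_ac)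
      finally show ?thesis .
    qed
    \<comment> \<open>\<open>c\<close> is largest at \<open>v\<close> but possibly also at
      centroids; the strictness comes from \<open>g\<close>.\<close>
    have less: "lfun (($) y) v < lfun (($) y) (centroid w)" if "w \<in> words lam" for w
    proof -
      have "centroid w \<in> K" unfolding K_def using that by (intro hull_inc) auto
      then have "\<epsilon> * (g \<bullet> v) < \<epsilon> * (g \<bullet> centroid w)" using g(1) g(2)[of "centroid w"] \<epsilon> by simp
      then have "F v < F (centroid w)" unfolding F_def using c(3)[OF cent[OF that]] by linarith
      then show ?thesis unfolding F_eq using B by simp
    qed
    define U where "U = (\<Inter>w\<in>words lam. {x :: (real, 'd) vec. lfun (($) x) v < lfun (($) x) (centroid w)})"
    have "open U"
      unfolding U_def lfun_def using fin
      by (intro open_INT ballI open_Collect_less continuous_intros) auto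
    moreover have "y \<in> U" using less by (simp add: U_def)
    ultimately have "\<not> U \<subseteq> \<Union>(arrangement lam)"
      using open_not_negligible negligible_arrangement negligible_subset by blast
    then obtain x where x: "x \<in> U" "x \<notin> \<Union>(arrangement lam)" by blast
    then obtain w where w: "lambda_permutation lam w" "realizes (($) x) w"
      using generic_iff_arrangement[of lam x, OF pos] generic_imp_realizes[of lam "($) x"]
      by (auto simp: lambda_permutation_def)
    then have ww: "w \<in> words lam" using words_iff_realizes by blast
    then have "length w = n" "w \<noteq> []" using len by auto
    moreover have "v \<in> ?Q" using vQ by (simp add: extreme_point_of_def)
    \<comment> \<open>The vector \<open>x\<close> realizes a word of its own, whose centroid is
      minimal on all of \<open>?Q\<close>, in particular against \<open>v\<close>; but
      \<open>U\<close> puts \<open>v\<close> strictly below every centroid.\<close>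
    ultimately have "lfun (($) x) (centroid w) \<le> lfun (($) x) v"
      using centroid_minimal(1)[OF w] by (elim monotone_path_polytopeE) auto
    moreover have "lfun (($) x) v < lfun (($) x) (centroid w)" using x(1) ww by (simp add: U_def)
    ultimately show False by simp
  qed
  \<comment> \<open>Extremality passes to the smaller convex set \<open>K\<close>, and extreme
    points of a hull are among its generators.\<close>
  then have "v extreme_point_of K"
    using vQ KQ unfolding extreme_point_of_def by blast
  then show ?thesis unfolding K_def by (rule extreme_point_of_convex_hull)
qed

text \<open>\<open>lifted_path\<close>, \<open>centroid\<close> and \<open>chamber\<close> are
  injective on \<open>words lam\<close>, with the coherent paths, the lower vertices and the regions
  as images, so all the counts reduce to \<open>card_words\<close>.\<close>

theorem theorem2p3:
  fixes lam :: "'d::{finite,linorder} \<Rightarrow> nat" and n :: nat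
  assumes "composition lam n"
  shows "(\<forall>w. lambda_permutation lam w \<longrightarrow>
            (coherent height (lifted_polytope lam) (lifted_path w) \<longleftrightarrow> \<not> nesting w)) \<and>
         card {lifted_path w | w. lambda_permutation lam w \<and>
                 coherent height (lifted_polytope lam) (lifted_path w)}
           = card {v. lower_vertex (monotone_path_polytope n lam) v} \<and>
         card {v. lower_vertex (monotone_path_polytope n lam) v}
           = card (regions (arrangement lam)) \<and>
         real (card (regions (arrangement lam)))
           = fact n / fact (n - CARD('d) + 1)"
proof -
  have pos: "\<And>i. 0 < lam i" and sum: "sum lam UNIV = n" using assms by (auto simp: composition_def)
  have n: "0 < n" using pos sum_pos[of UNIV lam] sum by simp
  have len: "length w = n \<and> w \<noteq> []" if "lambda_permutation lam w" for w
    using lambda_permutation_length[OF that] sum n by auto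
  then have len': "length w = n \<and> w \<noteq> []" if "w \<in> words lam" for w
    using that by (simp add: words_def)
  have coherent_iff: "coherent height (lifted_polytope lam) (lifted_path w) \<longleftrightarrow> \<not> nesting w"
    if w: "lambda_permutation lam w" for w
  proof
    show "\<not> nesting w" if "coherent height (lifted_polytope lam) (lifted_path w)"
      using coherent_imp_not_nesting[OF w _ that] len[OF w] by blast
    assume "\<not> nesting w"
    then obtain y :: "(real, 'd) vec" where "realizes (($) y) w"
      using w words_iff_realizes[of w lam] by (auto simp: words_def)
    then show "coherent height (lifted_polytope lam) (lifted_path w)"
      using realizes_imp_coherent[OF w] len[OF w] by blast
  qed
  then have "{lifted_path w | w. lambda_permutation lam w \<and>
      coherent height (lifted_polytope lam) (lifted_path w)} = lifted_path ` words lam"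
    by (auto simp: words_def)
  moreover have "inj_on lifted_path (words lam)"
  proof (rule inj_onI)
    show "w = w'" if "w \<in> words lam" "w' \<in> words lam" "lifted_path w = lifted_path w'" for w w'
      using lifted_path_inject[of w w'] len'[of w] len'[of w'] that by auto
  qed
  ultimately have paths: "card {lifted_path w | w. lambda_permutation lam w \<and>
      coherent height (lifted_polytope lam) (lifted_path w)} = card (words lam)"
    by (simp add: card_image)
  have "{v. lower_vertex (monotone_path_polytope n lam) v} = centroid ` words lam"
  proof (intro equalityI subsetI)
    fix v assume "v \<in> {v. lower_vertex (monotone_path_polytope n lam) v}"
    then show "v \<in> centroid ` words lam"
      using lower_vertex_centroid[OF card_words(1)[OF assms] pos len'] by blast
  next
    fix v assume "v \<in> centroid ` words lam"
    then obtain w where w: "w \<in> words lam" "v = centroid w" by blast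
    then obtain y :: "(real, 'd) vec" where "lambda_permutation lam w" "realizes (($) y) w"
      using words_iff_realizes by blast
    then show "v \<in> {v. lower_vertex (monotone_path_polytope n lam) v}"
      using centroid_lower_vertex[of lam w] len'[OF w(1)] w(2) by blast
  qed
  then have vertices: "card {v. lower_vertex (monotone_path_polytope n lam) v} = card (words lam)"
    using inj_on_centroid[OF len'] by (simp add: card_image)
  have "card (regions (arrangement lam)) = card (words lam)"
    using chamber_regions[of lam, OF pos] by (simp add: card_image)
  then show ?thesis using coherent_iff paths vertices card_words(2)[OF assms] by simp
qed

end
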